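(* Let $\mathbb{G}$ be a boundary coloured ribbon graph. Then $T_s(\mathbb{G};x,y,z)=T_{cps}(\mathbb{G}^*;y,z,x)$, where $\mathbb{G}^*$ is the vertex coloured ribbon graph dual to $\mathbb{G}$.
   Context: A ribbon graph $\mathbb{G}=(V,E)$ is a surface with boundary represented as a union of two finite sets of closed discs, vertices and edges, meeting in disjoint line segments, each on the boundary of exactly one vertex and one edge, each edge containing exactly two such segments; $F(\mathbb{G})$ is its set of boundary components. The geometric dual $\mathbb{G}^*$ caps off each boundary component of $\mathbb{G}$ with a disc; these discs are its vertices and its edges are those of $\mathbb{G}$, so vertices of $\mathbb{G}^*$ correspond to boundary components of $\mathbb{G}$. A boundary coloured ribbon graph has a partition $\mathcal{B}$ of $F(\mathbb{G})$ into boundary colour classes; a vertex coloured ribbon graph has a partition $\mathcal{V}$ of its vertex set into vertex colour classes. The dual of a boundary coloured ribbon graph $\mathbb{G}$ is the vertex coloured ribbon graph $\mathbb{G}^*$ whose vertex colouring is induced from the boundary colouring of $\mathbb{G}$. Parameters (for a ribbon graph $\mathbb{H}=(V,E)$): $b(A)$ = number of boundary components of ribbon subgraph $(V,A)$; $\rho(A)=\frac12(|A|+|V|-b(A))$. For a graph $H$, $r_H(A)$ is the rank (vertices minus components) of its spanning subgraph with edges $A$. For boundary coloured $\mathbb{G}$: $\mathbb{G}^*/\mathcal{B}$ is the graph on the boundary colour classes with an edge for each edge $e$ joining the classes of the boundary components touching $e$; $r_3(A)=r_{\mathbb{G}^*/\mathcal{B}}(E)-r_{\mathbb{G}^*/\mathcal{B}}(E\setminus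 A)$, $r_4(A)=|A|+r_{\mathbb{G}^*/\mathcal{B}}(E\setminus A)-r_{\mathbb{G}^*/\mathcal{B}}(E)-\rho(A)$, and $T_s(\mathbb{G};x,y,z)=\sum_{A\subseteq E}x^{\rho(E)-\rho(A)}y^{r_3(A)}z^{r_4(A)}$. For vertex coloured $\mathbb{H}$: $\mathbb{H}/\mathcal{V}$ is the graph on the vertex colour classes with an edge for each edge of $\mathbb{H}$ joining the classes of its ends; $r_1(A)=r_{\mathbb{H}/\mathcal{V}}(A)$, $r_2(A)=\rho(A)-r_{\mathbb{H}/\mathcal{V}}(A)$, and $T_{cps}(\mathbb{H};w,x,y)=\sum_{A\subseteq E}w^{r_1(E)-r_1(A)}x^{r_2(E)-r_2(A)}y^{|A|-\rho(A)}$. *)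

theory Defs
  imports "HOL-Analysis.Analysis" "HOL-Library.Poly_Mapping" "HOL-Library.Disjoint_Sets"
begin

text \<open>
  Ribbon graphs are rendered topologically.  The discs are subsets of an arbitrary ambient Hausdorff
  space, and a ribbon graph is the pair of its set of vertex discs \<open>V\<close> and its set of edge discs
  \<open>E\<close>; the underlying surface is \<open>\<Union>V \<union> \<Union>E\<close>.
\<close>

definition closed_disc :: "'a::t2_space set \<Rightarrow> bool" where
  "closed_disc D \<longleftrightarrow> D homeomorphic (cball 0 1 :: complex set)"

text \<open>
  The boundary of a surface in the sense of manifolds, which is in general different from the
  \<open>frontier\<close> in the ambient space: the points that have no neighbourhood within the surface
  homeomorphic to an open disc.
\<close>

definition surface_boundary :: "'a::t2_space set \<Rightarrow> 'a set" where
  "surface_boundary S =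
     {x \<in> S. \<nexists>U. openin (top_of_set S) U \<and> x \<in> U \<and> U homeomorphic (ball 0 1 :: complex set)}"

text \<open>
  Since the segments are disjoint, compact and finite in number, they are the connected components
  of the set in which vertices and edges meet.
\<close>

definition segments :: "'a::t2_space set set \<Rightarrow> 'a set set \<Rightarrow> 'a set set" where
  "segments V E = components (\<Union>V \<inter> \<Union>E)"

definition ribbon_graph :: "'a::t2_space set set \<Rightarrow> 'a set set \<Rightarrow> bool" where
  "ribbon_graph V E \<longleftrightarrow>
     finite V \<and> finite E \<and>
     (\<forall>D \<in> V \<union> E. closed_disc D) \<and>
     pairwise disjnt V \<and> pairwise disjnt E \<and>
     (\<forall>s \<in> segments V E.
        s homeomorphic {0..1::real} \<and>
        (\<exists>!v. v \<in> V \<and> s \<subseteq> surface_boundary v) \<and>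
        (\<exists>!e. e \<in> E \<and> s \<subseteq> surface_boundary e)) \<and>
     (\<forall>e \<in> E. card {s \<in> segments V E. s \<subseteq> e} = 2)"

definition boundary_components :: "'a::t2_space set set \<Rightarrow> 'a set set \<Rightarrow> 'a set set" where
  "boundary_components V A = components (surface_boundary (\<Union>V \<union> \<Union>A))"

definition boundary_coloured :: "'a::t2_space set set \<Rightarrow> 'a set set \<Rightarrow> 'a set set set \<Rightarrow> bool" where
  "boundary_coloured V E \<B> \<longleftrightarrow> ribbon_graph V E \<and> partition_on (boundary_components V E) \<B>"


text \<open>
  The surface of \<open>(V, E)\<close> need not leave room in its ambient space for the discs that are
  glued to it.  Therefore the dual \<open>(V', E')\<close> may live in another space, in which \<open>h\<close> embeds the
  surface: the edges of the dual are the edges of the embedded ribbon graph, and its vertices are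
  disjoint discs that cap off the boundary components of the embedded ribbon graph, one disc for
  each.
\<close>

definition geometric_dual ::
  "('a::t2_space \<Rightarrow> 'b::t2_space) \<Rightarrow> 'a set set \<Rightarrow> 'a set set \<Rightarrow> 'b set set \<Rightarrow> 'b set set \<Rightarrow> bool" where
  "geometric_dual h V E V' E' \<longleftrightarrow>
     (let S = \<Union>V \<union> \<Union>E in
      (\<exists>g. homeomorphism S (h ` S) h g) \<and>
      E' = (\<lambda>e. h ` e) ` E \<and>
      (\<exists>cap. bij_betw cap (boundary_components V E) V' \<and>
         (\<forall>f \<in> boundary_components V E.
            closed_disc (cap f) \<and> cap f \<inter> h ` S = h ` f \<and> surface_boundary (cap f) = h ` f)) \<and>
      pairwise disjnt V')"

text \<open>The vertices of the dual inherit the colours of the boundary components that they cap off.\<close>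

definition induced_colouring ::
  "('a::t2_space \<Rightarrow> 'b::t2_space) \<Rightarrow> 'a set set set \<Rightarrow> 'b set set \<Rightarrow> 'b set set set" where
  "induced_colouring h \<B> V' = (\<lambda>\<beta>. {v \<in> V'. \<exists>f \<in> \<beta>. surface_boundary v = h ` f}) ` \<B>"

definition coloured_dual ::
  "('a::t2_space \<Rightarrow> 'b::t2_space) \<Rightarrow> 'a set set \<Rightarrow> 'a set set \<Rightarrow> 'a set set set \<Rightarrow>
    'b set set \<Rightarrow> 'b set set \<Rightarrow> 'b set set set \<Rightarrow> bool" where
  "coloured_dual h V E \<B> V' E' \<V> \<longleftrightarrow>
     geometric_dual h V E V' E' \<and> \<V> = induced_colouring h \<B> V'"


text \<open>Graphs with loops and multiple edges; \<open>ends e\<close> is a singleton if \<open>e\<close> is a loop.\<close>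

record ('v, 'e) multigraph =
  nodes :: "'v set"
  links :: "'e set"
  ends :: "'e \<Rightarrow> 'v set"

definition connected_nodes :: "('v, 'e) multigraph \<Rightarrow> 'e set \<Rightarrow> ('v \<times> 'v) set" where
  "connected_nodes \<Gamma> A =
     {(u, v). \<exists>e \<in> A. u \<in> ends \<Gamma> e \<and> v \<in> ends \<Gamma> e}\<^sup>* \<inter> nodes \<Gamma> \<times> nodes \<Gamma>"

text \<open>Number of vertices minus number of connected components of the spanning subgraph on \<open>A\<close>.\<close>

definition graph_rank :: "('v, 'e) multigraph \<Rightarrow> 'e set \<Rightarrow> rat" where
  "graph_rank \<Gamma> A =
     of_nat (card (nodes \<Gamma>)) - of_nat (card (nodes \<Gamma> // connected_nodes \<Gamma> A))"

definition boundary_quotient ::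
  "'a::t2_space set set \<Rightarrow> 'a set set \<Rightarrow> 'a set set set \<Rightarrow> ('a set set, 'a set) multigraph" where
  "boundary_quotient V E \<B> =
     \<lparr>nodes = \<B>, links = E, ends = (\<lambda>e. {\<beta> \<in> \<B>. \<exists>f \<in> \<beta>. f \<inter> e \<noteq> {}})\<rparr>"

definition vertex_quotient ::
  "'a::t2_space set set \<Rightarrow> 'a set set \<Rightarrow> 'a set set set \<Rightarrow> ('a set set, 'a set) multigraph" where
  "vertex_quotient V E \<V> =
     \<lparr>nodes = \<V>, links = E, ends = (\<lambda>e. {c \<in> \<V>. \<exists>v \<in> c. v \<inter> e \<noteq> {}})\<rparr>"

definition rho :: "'a::t2_space set set \<Rightarrow> 'a set set \<Rightarrow> rat" where
  "rho V A = (of_nat (card A) + of_nat (card V) - of_nat (card (boundary_components V A))) / 2"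

definition r1 where
  "r1 V E \<V> A = graph_rank (vertex_quotient V E \<V>) A"

definition r2 where
  "r2 V E \<V> A = rho V A - graph_rank (vertex_quotient V E \<V>) A"

definition r3 where
  "r3 V E \<B> A =
     graph_rank (boundary_quotient V E \<B>) E - graph_rank (boundary_quotient V E \<B>) (E - A)"

definition r4 where
  "r4 V E \<B> A =
     of_nat (card A) + graph_rank (boundary_quotient V E \<B>) (E - A)
       - graph_rank (boundary_quotient V E \<B>) E - rho V A"


text \<open>
  As \<open>rho\<close> takes half-integer values on non-orientable ribbon graphs, the two invariants are
  polynomials with rational exponents.  They are elements of the ring of formal integer combinations
  of monomials, where a monomial maps each indeterminate (an element of the type \<open>'v\<close>) to its
  exponent.  The power \<open>x\<^sup>q\<close> of an indeterminate \<open>x\<close> is \<open>var_power x q\<close>.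
\<close>

type_synonym 'v frac_poly = "('v \<Rightarrow>\<^sub>0 rat) \<Rightarrow>\<^sub>0 int"

definition var_power :: "'v \<Rightarrow> rat \<Rightarrow> 'v frac_poly" where
  "var_power x q = Poly_Mapping.single (Poly_Mapping.single x q) 1"

definition T_s ::
  "'a::t2_space set set \<Rightarrow> 'a set set \<Rightarrow> 'a set set set \<Rightarrow> 'v \<Rightarrow> 'v \<Rightarrow> 'v \<Rightarrow> 'v frac_poly" where
  "T_s V E \<B> x y z =
     (\<Sum>A \<in> Pow E. var_power x (rho V E - rho V A) *
        var_power y (r3 V E \<B> A) * var_power z (r4 V E \<B> A))"

definition T_cps ::
  "'a::t2_space set set \<Rightarrow> 'a set set \<Rightarrow> 'a set set set \<Rightarrow> 'v \<Rightarrow> 'v \<Rightarrow> 'v \<Rightarrow> 'v frac_poly" where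
  "T_cps V E \<V> w x y =
     (\<Sum>A \<in> Pow E. var_power w (r1 V E \<V> E - r1 V E \<V> A) *
        var_power x (r2 V E \<V> E - r2 V E \<V> A) *
        var_power y (of_nat (card A) - rho V A))"

end

theory Submission
  imports Defs
begin

text \<open>
  Let \<open>S\<close> be the surface of the ribbon graph, embedded together with its caps.  For \<open>A \<subseteq> E\<close> the
  closed sets \<open>M = \<Union>V \<union> \<Union>A\<close> and \<open>N = \<Union>V' \<union> \<Union>(E - A)\<close> cover \<open>S\<close> and the caps, and both have the
  boundary \<open>M \<inter> N\<close>.  Hence \<open>A\<close> has as many boundary components as the complementary edge set in the
  dual, and the rest is bookkeeping with the exponents under \<open>A \<mapsto> E - A\<close>, since the two quotient
  graphs are isomorphic.

  That both boundaries equal \<open>M \<inter> N\<close> follows locally from two facts: a boundary point of one disc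
  stays on the boundary when closed sets away from it are added, and two discs glued along
  an arc of their boundaries form a disc around an interior point of that arc.  The points where a
  vertex, an edge and a cap meet need no local model: they are limits of points on vertex-edge
  arcs off the caps, and boundaries are closed.
\<close>

section \<open>Boundaries of surfaces and discs\<close>

text \<open>
  Allowing an arbitrary open set of the plane instead of a disc makes the notion visibly local.
\<close>

definition locally_planar :: "'a::topological_space set \<Rightarrow> 'a \<Rightarrow> bool" where
  "locally_planar X p \<longleftrightarrow>
     (\<exists>U T. openin (top_of_set X) U \<and> p \<in> U \<and> open (T :: complex set) \<and> U homeomorphic T)"

text \<open>An open planar chart contains a round ball around the image of \<open>p\<close>. Pulling
  this ball back gives a smaller neighbourhood that is homeomorphic to the unit disc.\<close>

lemma surface_boundary_eq: "surface_boundary X = {p \<in> X. \<not> locally_planar X p}"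
proof -
  have "(\<exists>U. openin (top_of_set X) U \<and> p \<in> U \<and> U homeomorphic (ball 0 1 :: complex set))
      \<longleftrightarrow> locally_planar X p" for p
  proof
    assume "locally_planar X p"
    then obtain U T f g where U: "openin (top_of_set X) U" "p \<in> U" "open (T :: complex set)"
      and fg: "homeomorphism U T f g"
      unfolding locally_planar_def homeomorphic_def by blast
    have "f p \<in> T"
      using fg U(2) by (auto simp: homeomorphism_def)
    then obtain r where r: "r > 0" "ball (f p) r \<subseteq> T"
      by (rule openE[OF U(3)])
    have hom: "homeomorphism T U g f"
      using fg homeomorphism_symD by blast
    let ?U = "g ` ball (f p) r"
    have "openin (top_of_set U) ?U"
      by (rule homeomorphism_imp_open_map[OF hom]) (simp add: r(2) open_subset)
    then have 1: "openin (top_of_set X) ?U"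
      using U(1) openin_trans by blast
    have "g (f p) = p"
      using fg U(2) by (simp add: homeomorphism_def)
    then have 2: "p \<in> ?U"
      using r(1) by (metis centre_in_ball imageI)
    have "?U \<subseteq> U"
      using hom r(2) by (auto simp: homeomorphism_def)
    then have "homeomorphism (ball (f p) r) ?U g f"
      using homeomorphism_of_subsets[OF hom r(2)] by blast
    then have "?U homeomorphic ball (f p) r"
      using homeomorphic_def homeomorphic_sym by blast
    also have "ball (f p) r homeomorphic (ball 0 1 :: complex set)"
      using r(1) by (simp add: homeomorphic_balls)
    finally show "\<exists>U. openin (top_of_set X) U \<and> p \<in> U \<and> U homeomorphic (ball 0 1 :: complex set)"
      using 1 2 by blast
  qed (auto simp: locally_planar_def)
  then show ?thesis
    by (auto simp: surface_boundary_def)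
qed

lemma surface_boundary_subset: "surface_boundary X \<subseteq> X"
  by (auto simp: surface_boundary_eq)

text \<open>A chart at \<open>p\<close> is cut down to \<open>W\<close>. Its image remains open in
  the plane, and what is left of the chart is open in \<open>Y\<close> because it is open in
  \<open>W\<close>.\<close>

lemma locally_planar_open_subset:
  assumes "openin (top_of_set X) W" "openin (top_of_set Y) W" "p \<in> W" "locally_planar X p"
  shows "locally_planar Y p"
proof -
  obtain U T f g where U: "openin (top_of_set X) U" "p \<in> U" "open (T :: complex set)"
    and fg: "homeomorphism U T f g"
    using assms(4) unfolding locally_planar_def homeomorphic_def by blast
  have "openin (top_of_set X) (U \<inter> W)"
    using U(1) assms(1) by blast
  then have UW: "openin (top_of_set U) (U \<inter> W)" "openin (top_of_set W) (U \<inter> W)"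
    using U(1) assms(1) openin_imp_subset openin_subset_trans by (metis inf_le1, metis inf_le2)
  have "openin (top_of_set T) (f ` (U \<inter> W))"
    by (rule homeomorphism_imp_open_map[OF fg UW(1)])
  then have 1: "open (f ` (U \<inter> W))"
    using U(3) openin_open_trans by blast
  have "homeomorphism (U \<inter> W) (f ` (U \<inter> W)) f g"
    by (rule homeomorphism_of_subsets[OF fg, of _ "f ` (U \<inter> W)"])
       (use fg in \<open>auto simp: homeomorphism_def\<close>)
  then have "U \<inter> W homeomorphic f ` (U \<inter> W)"
    using homeomorphic_def by blast
  moreover have "openin (top_of_set Y) (U \<inter> W)"
    using UW(2) assms(2) openin_trans by blast
  ultimately show ?thesis
    unfolding locally_planar_def using 1 U(2) assms(3) by blast
qed

lemma surface_boundary_open_subset: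
  assumes "openin (top_of_set X) W" "openin (top_of_set Y) W" "p \<in> W"
  shows "p \<in> surface_boundary X \<longleftrightarrow> p \<in> surface_boundary Y"
proof -
  have "W \<subseteq> X" "W \<subseteq> Y"
    using assms openin_imp_subset by blast+
  then show ?thesis
    using assms(3) locally_planar_open_subset[OF assms]
      locally_planar_open_subset[OF assms(2,1,3)]
    by (auto simp: surface_boundary_eq)
qed

text \<open>The set \<open>X - R\<close> is open both in \<open>X\<close> and in
  \<open>X \<union> R\<close>, so the two spaces agree near \<open>p\<close>. This is the means by
  which all discs that miss \<open>p\<close> are discarded below.\<close>

lemma surface_boundary_Un_closed:
  assumes "closed R" "p \<notin> R"
  shows "p \<in> surface_boundary (X \<union> R) \<longleftrightarrow> p \<in> surface_boundary X"
proof (cases "p \<in> X")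
  case True
  have "openin (top_of_set X) (X - R)" "openin (top_of_set (X \<union> R)) (X - R)"
    using assms(1) by (auto simp: openin_open intro!: exI[of _ "- R"])
  then show ?thesis
    using surface_boundary_open_subset True assms(2) by blast
next
  case False
  then show ?thesis
    using assms(2) surface_boundary_subset by blast
qed

text \<open>A chart serves all of its points, so local planarity is an open condition. Closedness is
  what later allows limits of boundary points to be taken.\<close>

lemma closed_surface_boundary:
  assumes "closed X"
  shows "closed (surface_boundary X)"
proof -
  have "openin (top_of_set X) {p \<in> X. locally_planar X p}"
  proof (subst openin_subopen, safe)
    fix p assume "p \<in> X" "locally_planar X p"
    then obtain U T where U: "openin (top_of_set X) U" "p \<in> U"
      "open (T :: complex set)" "U homeomorphic T"
      unfolding locally_planar_def by blast
    then have "U \<subseteq> {p \<in> X. locally_planar X p}"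
      using openin_imp_subset unfolding locally_planar_def by blast
    then show "\<exists>T. openin (top_of_set X) T \<and> p \<in> T \<and> T \<subseteq> {p \<in> X. locally_planar X p}"
      using U by blast
  qed
  moreover have "surface_boundary X = X - {p \<in> X. locally_planar X p}"
    by (auto simp: surface_boundary_eq)
  ultimately have "closedin (top_of_set X) (surface_boundary X)"
    by (simp add: closedin_diff)
  then show ?thesis
    using assms closedin_closed_trans by blast
qed

lemma locally_planar_homeomorphism:
  assumes "homeomorphism X Y h k" "p \<in> X" "locally_planar X p"
  shows "locally_planar Y (h p)"
proof -
  obtain U T where U: "openin (top_of_set X) U" "p \<in> U" "open (T :: complex set)" "U homeomorphic T"
    using assms(3) unfolding locally_planar_def by blast
  have "U \<subseteq> X"
    using U(1) openin_imp_subset by blast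
  then have "homeomorphism U (h ` U) h k"
    by (intro homeomorphism_of_subsets[OF assms(1), of _ "h ` U"])
       (use assms(1) in \<open>auto simp: homeomorphism_def\<close>)
  then have "h ` U homeomorphic T"
    using U(4) by (meson homeomorphic_def homeomorphic_sym homeomorphic_trans)
  then show ?thesis
    unfolding locally_planar_def
    using homeomorphism_imp_open_map[OF assms(1) U(1)] U(2,3) by blast
qed

lemma surface_boundary_homeomorphism:
  assumes "homeomorphism X Y h k"
  shows "surface_boundary Y = h ` surface_boundary X"
proof -
  have kh: "homeomorphism Y X k h" "h ` X = Y" "\<And>x. x \<in> X \<Longrightarrow> k (h x) = x"
    using assms by (auto simp: homeomorphism_def)
  have "locally_planar Y (h p) \<longleftrightarrow> locally_planar X p" if "p \<in> X" for p
    using locally_planar_homeomorphism[OF assms that] kh that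
      locally_planar_homeomorphism[OF kh(1), of "h p"] by auto
  then show ?thesis
    using kh(2) by (auto simp: surface_boundary_eq)
qed

section \<open>Closed discs and their boundary circles\<close>

lemma surface_boundary_cball: "surface_boundary (cball 0 1 :: complex set) = sphere 0 1"
proof -
  have "\<not> locally_planar (cball 0 1) p" if "p \<in> sphere 0 1" for p :: complex
  proof
    assume "locally_planar (cball 0 1) p"
    then obtain U T f g where U: "openin (top_of_set (cball 0 1)) U" "p \<in> U" "open (T :: complex set)"
      and fg: "homeomorphism U T f g"
      unfolding locally_planar_def homeomorphic_def by blast
    \<comment> \<open>Invariance of domain: as an injective continuous image of a planar open set,
      \<open>U\<close> is open in the plane itself and hence lies in the interior of the closed
      disc.\<close>
    have "continuous_on T g" "inj_on g T" "g ` T = U"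
      using fg by (auto simp: homeomorphism_def intro!: inj_on_inverseI)
    then have "open U"
      using invariance_of_domain[of T g] U(3) by auto
    moreover have "U \<subseteq> cball 0 1"
      using U(1) openin_imp_subset by blast
    ultimately have "U \<subseteq> ball 0 1"
      by (metis interior_cball interior_maximal)
    then show False
      using U(2) that by auto
  qed
  moreover have "locally_planar (cball 0 1) p" if "p \<in> ball 0 1" for p :: complex
    unfolding locally_planar_def using that
    by (intro exI[of _ "ball 0 1"]) (auto simp: open_subset intro: homeomorphic_refl)
  ultimately show ?thesis
    by (force simp: surface_boundary_eq)
qed

lemma closed_discE:
  assumes "closed_disc D"
  obtains k k' where "homeomorphism (cball 0 1 :: complex set) D k k'"
    "surface_boundary D = k ` sphere 0 1"
proof -
  obtain k k' where "homeomorphism (cball 0 1 :: complex set) D k k'"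
    using assms homeomorphic_sym unfolding closed_disc_def homeomorphic_def by blast
  then show thesis
    using that surface_boundary_homeomorphism surface_boundary_cball by metis
qed

lemma
  assumes "closed_disc D"
  shows closed_closed_disc: "closed D"
    and connected_surface_boundary_disc: "connected (surface_boundary D)"
    and surface_boundary_disc_nonempty: "surface_boundary D \<noteq> {}"
proof -
  obtain k k' where k: "homeomorphism (cball 0 1 :: complex set) D k k'"
    "surface_boundary D = k ` sphere 0 1"
    using assms closed_discE by blast
  then have cont: "continuous_on (cball 0 1) k" "k ` cball 0 1 = D"
    by (auto simp: homeomorphism_def)
  then have "compact D"
    by (metis compact_cball compact_continuous_image)
  then show "closed D"
    by (rule compact_imp_closed)
  have "continuous_on (sphere 0 1) k"
    using cont(1) continuous_on_subset sphere_cball by blast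
  then show "connected (surface_boundary D)"
    unfolding k(2) by (intro connected_continuous_image connected_sphere) auto
  show "surface_boundary D \<noteq> {}"
    unfolding k(2) by simp
qed

text \<open>The arc is the image of a short arc of the unit circle, parametrised by the angle from
  the point \<open>u\<close> that corresponds to \<open>p\<close>.\<close>

lemma surface_boundary_disc_arc:
  assumes "closed_disc D" "p \<in> surface_boundary D" "open W" "p \<in> W"
  obtains \<gamma> :: "real \<Rightarrow> 'a::t2_space"
  where "continuous_on {-1..1} \<gamma>" "inj_on \<gamma> {-1..1}" "\<gamma> 0 = p"
    "\<gamma> ` {-1..1} \<subseteq> surface_boundary D \<inter> W"
proof -
  obtain k k' where k: "homeomorphism (cball 0 1 :: complex set) D k k'"
    "surface_boundary D = k ` sphere 0 1"
    using assms(1) closed_discE by blast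
  then have cont: "continuous_on (cball 0 1) k" and inj: "inj_on k (cball 0 1)"
    by (auto simp: homeomorphism_def intro!: inj_on_inverseI)
  obtain u where u: "u \<in> sphere 0 1" "k u = p"
    using assms(2) k(2) by auto
  let ?c = "\<lambda>t::real. u * cis t"
  have c: "?c ` UNIV \<subseteq> sphere 0 1"
    using u(1) by (auto simp: norm_mult)
  have "continuous_on UNIV (k \<circ> ?c)"
    by (intro continuous_on_compose continuous_intros continuous_on_subset[OF cont])
       (use c in auto)
  then have "open ((k \<circ> ?c) -` W)"
    by (rule open_vimage[OF assms(3)])
  moreover have "0 \<in> (k \<circ> ?c) -` W"
    using u(2) assms(4) by simp
  ultimately obtain r where r: "r > 0" "cball 0 r \<subseteq> (k \<circ> ?c) -` W"
    by (meson open_contains_cball)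
  \<comment> \<open>The bound \<open>r\<close> keeps the arc inside \<open>W\<close>; the bound 1
    keeps the angles between \<open>-pi/2\<close> and \<open>pi/2\<close>, where the sine is
    injective.\<close>
  define \<delta> where "\<delta> = min r 1"
  have \<delta>: "0 < \<delta>" "\<delta> \<le> 1" "\<delta> \<le> r"
    using r(1) by (auto simp: \<delta>_def)
  define \<gamma> where "\<gamma> t = k (?c (\<delta> * t))" for t
  have bound: "\<bar>\<delta> * t\<bar> \<le> \<delta>" if "t \<in> {-1..1}" for t
    using that \<delta>(1) by (auto simp: abs_mult)
  show thesis
  proof
    show "continuous_on {-1..1} \<gamma>"
      unfolding \<gamma>_def using u(1)
      by (intro continuous_on_compose2[OF cont] continuous_intros) (auto simp: norm_mult)
    show "inj_on \<gamma> {-1..1}"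
    proof
      fix s t assume st: "s \<in> {-1..1}" "t \<in> {-1..1}" "\<gamma> s = \<gamma> t"
      have "?c (\<delta> * s) = ?c (\<delta> * t)"
        by (rule inj_onD[OF inj]) (use u(1) st(3) in \<open>auto simp: norm_mult \<gamma>_def\<close>)
      then have "cis (\<delta> * s) = cis (\<delta> * t)"
        using u(1) by auto
      then have "sin (\<delta> * s) = sin (\<delta> * t)"
        by (simp add: complex_eq_iff)
      moreover have "\<bar>\<delta> * s\<bar> \<le> pi / 2" "\<bar>\<delta> * t\<bar> \<le> pi / 2"
        using bound[OF st(1)] bound[OF st(2)] \<delta>(2) pi_ge_two by linarith+
      ultimately have "\<delta> * s = \<delta> * t"
        using sin_inj_pi[of "\<delta> * s" "\<delta> * t"] by linarith
      then show "s = t"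
        using \<delta>(1) by simp
    qed
    show "\<gamma> 0 = p"
      using u(2) by (simp add: \<gamma>_def)
    have "\<gamma> t \<in> surface_boundary D \<inter> W" if "t \<in> {-1..1}" for t
    proof
      show "\<gamma> t \<in> surface_boundary D"
        unfolding \<gamma>_def k(2) using u(1) by (auto simp: norm_mult)
      have "\<delta> * t \<in> cball 0 r"
        using bound[OF that] \<delta>(3) by simp
      then show "\<gamma> t \<in> W"
        using r(2) unfolding \<gamma>_def by auto
    qed
    then show "\<gamma> ` {-1..1} \<subseteq> surface_boundary D \<inter> W"
      by auto
  qed
qed

section \<open>Gluing two discs along an arc\<close>

text \<open>
  In the coordinates \<open>k\<close> of the disc, the collar of the arc is
  \<open>(x, y) \<mapsto> (1 - y) k\<inverse>(\<gamma> x)\<close>.  As this formula also makes sense for negative \<open>y\<close>, invariance of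
  domain in the plane shows that the collar covers a neighbourhood of \<open>\<gamma> 0\<close> in the disc.
\<close>

lemma disc_collar:
  fixes \<gamma> :: "real \<Rightarrow> 'a::t2_space"
  defines "Q \<equiv> {z. \<bar>Re z\<bar> \<le> 1 \<and> 0 \<le> Im z \<and> Im z \<le> 1/2}"
  assumes "closed_disc D" and \<gamma>: "continuous_on {-1..1} \<gamma>" "inj_on \<gamma> {-1..1}"
    "\<gamma> ` {-1..1} \<subseteq> surface_boundary D"
  obtains g W where "continuous_on Q g" "inj_on g Q" "g ` Q \<subseteq> D"
    "\<forall>x\<in>{-1..1}. g (complex_of_real x) = \<gamma> x"
    "\<forall>z\<in>Q. g z \<in> surface_boundary D \<longrightarrow> Im z = 0"
    "open W" "\<gamma> 0 \<in> W" "D \<inter> W \<subseteq> g ` {z. \<bar>Re z\<bar> < 1 \<and> 0 \<le> Im z \<and> Im z < 1/2}"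
proof -
  obtain k k' where k: "homeomorphism (cball 0 1 :: complex set) D k k'"
    and bd: "surface_boundary D = k ` sphere 0 1"
    using assms(2) closed_discE by blast
  have contk: "continuous_on (cball 0 1) k" and contk': "continuous_on D k'"
    and k'k: "\<And>z. z \<in> cball 0 1 \<Longrightarrow> k' (k z) = z" and kk': "\<And>p. p \<in> D \<Longrightarrow> k (k' p) = p"
    and kD: "k ` cball 0 1 = D" and k'D: "k' ` D = cball 0 1"
    using k by (auto simp: homeomorphism_def)
  have \<gamma>D: "\<gamma> ` {-1..1} \<subseteq> D"
    using \<gamma>(3) surface_boundary_subset by blast
  define \<beta> where "\<beta> = k' \<circ> \<gamma>"
  have contb: "continuous_on {-1..1} \<beta>"
    unfolding \<beta>_def by (intro continuous_on_compose \<gamma>(1) continuous_on_subset[OF contk' \<gamma>D])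
  have k\<beta>: "k (\<beta> x) = \<gamma> x" if "x \<in> {-1..1}" for x
    unfolding \<beta>_def comp_apply using that \<gamma>D by (intro kk') blast
  have normb: "norm (\<beta> x) = 1" if x: "x \<in> {-1..1}" for x
  proof -
    have "\<gamma> x \<in> surface_boundary D"
      using \<gamma>(3) x by blast
    then obtain u where "u \<in> sphere 0 1" "\<gamma> x = k u"
      unfolding bd by blast
    then show ?thesis
      using k'k[of u] by (simp add: \<beta>_def)
  qed
  have injb: "inj_on \<beta> {-1..1}"
    by (rule inj_onI) (metis \<gamma>(2) inj_onD k\<beta>)
  define G where "G z = of_real (1 - Im z) * \<beta> (Re z)" for z
  let ?F = "{z. \<bar>Re z\<bar> \<le> 1 \<and> \<bar>Im z\<bar> \<le> 1/2}"
  let ?R = "{z. \<bar>Re z\<bar> < 1 \<and> \<bar>Im z\<bar> < 1/2}"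
  \<comment> \<open>The norm recovers \<open>Im z\<close>. This yields injectivity of
    \<open>G\<close>, and shows that the part of the rectangle sent into the disc is exactly the one
    with \<open>0 \<le> Im z\<close>, the circle corresponding to \<open>Im z = 0\<close>.\<close>
  have normG: "norm (G z) = 1 - Im z" if "z \<in> ?F" for z
  proof -
    have "Re z \<in> {-1..1}" "\<bar>1 - Im z\<bar> = 1 - Im z"
      using that by (auto simp: abs_le_iff)
    then show ?thesis
      unfolding G_def norm_mult norm_of_real using normb[of "Re z"] by simp
  qed
  have contG: "continuous_on ?F G"
    unfolding G_def by (intro continuous_intros continuous_on_compose2[OF contb]) auto
  have injG: "inj_on G ?F"
  proof
    fix z w assume zw: "z \<in> ?F" "w \<in> ?F" "G z = G w"
    then have im: "Im z = Im w"
      using normG[OF zw(1)] normG[OF zw(2)] by simp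
    then have "\<beta> (Re z) = \<beta> (Re w)"
      using zw unfolding G_def by auto
    then have "Re z = Re w"
      using zw injb by (auto simp: inj_on_def abs_le_iff)
    then show "z = w"
      using im complex_eqI by blast
  qed
  have "open ?R"
    by (intro open_Collect_conj open_Collect_less continuous_intros)
  moreover have RF: "?R \<subseteq> ?F"
    by auto
  ultimately have openG: "open (G ` ?R)"
    by (intro invariance_of_domain continuous_on_subset[OF contG RF] inj_on_subset[OF injG RF])
  \<comment> \<open>The neighbourhood \<open>W\<close> comes from the part of the open image that
    lies in the closed disc, carried over to \<open>D\<close>.\<close>
  have "openin (top_of_set (cball 0 1)) (cball 0 1 \<inter> G ` ?R)"
    using openG by (simp add: openin_open_Int)
  then have "openin (top_of_set D) (k ` (cball 0 1 \<inter> G ` ?R))"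
    by (rule homeomorphism_imp_open_map[OF k])
  then obtain W where W: "open W" "k ` (cball 0 1 \<inter> G ` ?R) = D \<inter> W"
    unfolding openin_open by blast
  have QF: "Q \<subseteq> ?F"
    by (auto simp: Q_def)
  have GQ: "G z \<in> cball 0 1" if "z \<in> Q" for z
    using normG[of z] that QF by (auto simp: Q_def)
  show thesis
  proof
    show "continuous_on Q (k \<circ> G)"
      using GQ QF
      by (intro continuous_on_compose continuous_on_subset[OF contG] continuous_on_subset[OF contk])
         auto
    show "inj_on (k \<circ> G) Q"
    proof
      fix z w assume zw: "z \<in> Q" "w \<in> Q" "(k \<circ> G) z = (k \<circ> G) w"
      then have "G z = G w"
        by (metis GQ comp_apply k'k)
      then show "z = w"
        using zw injG QF by (auto simp: inj_on_def)
    qed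
    show "(k \<circ> G) ` Q \<subseteq> D"
      using GQ kD by auto
    show "\<forall>x\<in>{-1..1}. (k \<circ> G) (complex_of_real x) = \<gamma> x"
      using k\<beta> by (simp add: G_def)
    show "\<forall>z\<in>Q. (k \<circ> G) z \<in> surface_boundary D \<longrightarrow> Im z = 0"
    proof (intro ballI impI)
      fix z assume z: "z \<in> Q" "(k \<circ> G) z \<in> surface_boundary D"
      obtain u where u: "u \<in> sphere 0 1" "k (G z) = k u"
        using z(2) unfolding bd by auto
      then have "G z = u"
        using k'k GQ[OF z(1)] by (metis sphere_cball subsetD)
      then show "Im z = 0"
        using u(1) normG[of z] z(1) QF by auto
    qed
    show "open W"
      by (fact W(1))
    have "\<gamma> 0 = k (G 0)" "G 0 \<in> cball 0 1" "0 \<in> ?R"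
      using k\<beta>[of 0] normb[of 0] by (auto simp: G_def)
    then have "\<gamma> 0 \<in> D \<inter> W"
      unfolding W(2)[symmetric] by blast
    then show "\<gamma> 0 \<in> W"
      by blast
    have "w \<in> (k \<circ> G) ` {z. \<bar>Re z\<bar> < 1 \<and> 0 \<le> Im z \<and> Im z < 1/2}"
      if w: "w \<in> D \<inter> W" for w
    proof -
      obtain z where z: "w = k (G z)" "G z \<in> cball 0 1" "z \<in> ?R"
        using w unfolding W(2)[symmetric] by blast
      then have "0 \<le> Im z"
        using normG[of z] by auto
      then show ?thesis
        using z by auto
    qed
    then show "D \<inter> W \<subseteq> (k \<circ> G) ` {z. \<bar>Re z\<bar> < 1 \<and> 0 \<le> Im z \<and> Im z < 1/2}"
      by blast
  qed
qed

text \<open>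
  The two collars, one of them reflected, fit together to a planar chart around \<open>\<gamma> 0\<close>.
\<close>

lemma glued_discs_interior:
  fixes \<gamma> :: "real \<Rightarrow> 'a::t2_space"
  assumes D: "closed_disc D" "closed_disc D'"
    and meet: "D \<inter> D' \<subseteq> surface_boundary D \<inter> surface_boundary D'"
    and \<gamma>: "continuous_on {-1..1} \<gamma>" "inj_on \<gamma> {-1..1}"
      "\<gamma> ` {-1..1} \<subseteq> surface_boundary D \<inter> surface_boundary D'"
    and X: "D \<union> D' \<subseteq> X" "open W" "\<gamma> 0 \<in> W" "X \<inter> W \<subseteq> D \<union> D'"
  shows "\<gamma> 0 \<notin> surface_boundary X"
proof -
  let ?Q = "{z. \<bar>Re z\<bar> \<le> 1 \<and> 0 \<le> Im z \<and> Im z \<le> 1/2}"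
  let ?H = "{z. \<bar>Re z\<bar> < 1 \<and> 0 \<le> Im z \<and> Im z < 1/2}"
  have \<gamma>D: "\<gamma> ` {-1..1} \<subseteq> surface_boundary D" "\<gamma> ` {-1..1} \<subseteq> surface_boundary D'"
    using \<gamma>(3) by blast+
  obtain g U where g: "continuous_on ?Q g" "inj_on g ?Q" "g ` ?Q \<subseteq> D"
    "\<forall>x\<in>{-1..1}. g (complex_of_real x) = \<gamma> x"
    "\<forall>z\<in>?Q. g z \<in> surface_boundary D \<longrightarrow> Im z = 0"
    "open U" "\<gamma> 0 \<in> U" "D \<inter> U \<subseteq> g ` ?H"
    by (rule disc_collar[OF D(1) \<gamma>(1,2) \<gamma>D(1)])
  obtain g' U' where g': "continuous_on ?Q g'" "inj_on g' ?Q" "g' ` ?Q \<subseteq> D'"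
    "\<forall>x\<in>{-1..1}. g' (complex_of_real x) = \<gamma> x"
    "\<forall>z\<in>?Q. g' z \<in> surface_boundary D' \<longrightarrow> Im z = 0"
    "open U'" "\<gamma> 0 \<in> U'" "D' \<inter> U' \<subseteq> g' ` ?H"
    by (rule disc_collar[OF D(2) \<gamma>(1,2) \<gamma>D(2)])
  define \<Phi> where "\<Phi> z = (if Im z \<ge> 0 then g z else g' (cnj z))" for z
  let ?Q' = "{z. \<bar>Re z\<bar> \<le> 1 \<and> -1/2 \<le> Im z \<and> Im z \<le> 0}"
  let ?R = "{z. \<bar>Re z\<bar> < 1 \<and> \<bar>Im z\<bar> < 1/2}"
  let ?F = "?Q \<union> ?Q'"
  have cl: "closed ?Q" "closed ?Q'"
    by (intro closed_Collect_conj closed_Collect_le continuous_intros)+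
  have cont: "continuous_on ?F \<Phi>"
    unfolding \<Phi>_def
  proof (rule continuous_on_cases[OF cl g(1)])
    show "continuous_on ?Q' (\<lambda>z. g' (cnj z))"
      by (intro continuous_on_compose2[OF g'(1)] continuous_intros) auto
    show "\<forall>z. z \<in> ?Q \<and> \<not> 0 \<le> Im z \<or> z \<in> ?Q' \<and> 0 \<le> Im z \<longrightarrow> g z = g' (cnj z)"
    proof (intro allI impI)
      fix z assume "z \<in> ?Q \<and> \<not> 0 \<le> Im z \<or> z \<in> ?Q' \<and> 0 \<le> Im z"
      then have "z = complex_of_real (Re z)" "Re z \<in> {-1..1}"
        by (auto simp: complex_eq_iff abs_le_iff)
      then show "g z = g' (cnj z)"
        using bspec[OF g(4)] bspec[OF g'(4)] by (metis complex_cnj_complex_of_real)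
    qed
  qed
  \<comment> \<open>The halves overlap only as intended: a common value lies in
    \<open>D \<inter> D'\<close>, hence on both boundaries, so both parameters are real. There both
    collars coincide with the injective \<open>\<gamma>\<close>.\<close>
  have cross: "z = w \<and> Im w = 0" if zw: "z \<in> ?Q" "w \<in> ?Q" "g z = g' w" for z w
  proof -
    have "g z \<in> D \<inter> D'"
      using zw g(3) g'(3) by auto
    then have "g z \<in> surface_boundary D" "g z \<in> surface_boundary D'"
      using meet by blast+
    then have im: "Im z = 0" "Im w = 0"
      using bspec[OF g(5) zw(1)] bspec[OF g'(5) zw(2)] unfolding zw(3) by blast+
    then have *: "z = complex_of_real (Re z)" "w = complex_of_real (Re w)"
      "Re z \<in> {-1..1}" "Re w \<in> {-1..1}"
      using zw(1,2) by (auto simp: complex_eq_iff abs_le_iff)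
    then have "\<gamma> (Re z) = \<gamma> (Re w)"
      using zw(3) bspec[OF g(4) *(3)] bspec[OF g'(4) *(4)] by simp
    then have "Re z = Re w"
      using inj_onD[OF \<gamma>(2)] *(3,4) by blast
    then show ?thesis
      using *(1,2) im by simp
  qed
  have inj: "inj_on \<Phi> ?F"
  proof
    fix z w assume zw: "z \<in> ?F" "w \<in> ?F" "\<Phi> z = \<Phi> w"
    consider "Im z \<ge> 0" "Im w \<ge> 0" | "Im z < 0" "Im w < 0"
      | "Im z \<ge> 0" "Im w < 0" | "Im z < 0" "Im w \<ge> 0"
      by linarith
    then show "z = w"
    proof cases
      case 1
      then have "z \<in> ?Q" "w \<in> ?Q" "g z = g w"
        using zw by (auto simp: \<Phi>_def)
      then show ?thesis
        using inj_onD[OF g(2)] by blast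
    next
      case 2
      then have "cnj z \<in> ?Q" "cnj w \<in> ?Q" "g' (cnj z) = g' (cnj w)"
        using zw by (auto simp: \<Phi>_def)
      then have "cnj z = cnj w"
        using inj_onD[OF g'(2)] by blast
      then show ?thesis
        by simp
    next
      case 3
      then have "z \<in> ?Q" "cnj w \<in> ?Q" "g z = g' (cnj w)"
        using zw by (auto simp: \<Phi>_def)
      then have "z = cnj w \<and> Im (cnj w) = 0"
        by (rule cross)
      then show ?thesis
        using 3 by simp
    next
      case 4
      then have "w \<in> ?Q" "cnj z \<in> ?Q" "g w = g' (cnj z)"
        using zw by (auto simp: \<Phi>_def)
      then have "w = cnj z \<and> Im (cnj z) = 0"
        by (rule cross)
      then show ?thesis
        using 4 by simp
    qed
  qed
  have "bounded ?F"
    unfolding bounded_iff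
  proof (intro exI ballI)
    fix z assume "z \<in> ?F"
    then show "norm z \<le> 2"
      using cmod_le[of z] by auto
  qed
  \<comment> \<open>A continuous injection of a compact space into a Hausdorff space is a
    homeomorphism onto its image. The closed rectangle is used for this purpose; the chart itself
    comes from the open one.\<close>
  then have "compact ?F"
    using cl compact_eq_bounded_closed by blast
  then obtain \<Psi> where hom: "homeomorphism ?F (\<Phi> ` ?F) \<Phi> \<Psi>"
    using homeomorphism_compact[OF _ cont refl inj] by blast
  have "\<Phi> z \<in> D \<union> D'" if "z \<in> ?F" for z
  proof (cases "Im z \<ge> 0")
    case False
    then have "cnj z \<in> ?Q"
      using that by auto
    then have "g' (cnj z) \<in> D'"
      using g'(3) by blast
    then show ?thesis
      using False by (simp add: \<Phi>_def)
  next
    case True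
    then have "z \<in> ?Q"
      using that by auto
    then have "g z \<in> D"
      using g(3) by blast
    then show ?thesis
      using True by (simp add: \<Phi>_def)
  qed
  then have FX: "\<Phi> ` ?F \<subseteq> D \<union> D'"
    by (rule image_subsetI)
  have RF: "?R \<subseteq> ?F"
    by auto
  have DU: "D \<inter> U \<subseteq> \<Phi> ` ?R"
  proof
    fix p assume "p \<in> D \<inter> U"
    then obtain z where "z \<in> ?H" "p = g z"
      using g(8) by blast
    then show "p \<in> \<Phi> ` ?R"
      by (intro image_eqI[of _ _ z]) (auto simp: \<Phi>_def)
  qed
  have DU': "D' \<inter> U' \<subseteq> \<Phi> ` ?R"
  proof
    fix p assume "p \<in> D' \<inter> U'"
    then obtain z where z: "z \<in> ?H" "p = g' z"
      using g'(8) by blast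
    have "p = \<Phi> (cnj z)"
    proof (cases "Im z = 0")
      case True
      then have "z = complex_of_real (Re z)" "Re z \<in> {-1..1}"
        using z(1) by (auto simp: complex_eq_iff abs_less_iff)
      then have "g z = g' z" "cnj z = z"
        using bspec[OF g(4)] bspec[OF g'(4)] by (metis, metis complex_cnj_complex_of_real)
      then show ?thesis
        using True z(2) by (simp add: \<Phi>_def)
    qed (use z in \<open>auto simp: \<Phi>_def\<close>)
    then show "p \<in> \<Phi> ` ?R"
      by (rule image_eqI) (use z(1) in auto)
  qed
  \<comment> \<open>Within \<open>W\<close> only the two discs are present, and within
    \<open>U\<close> and \<open>U'\<close> they are covered by their collars. Hence \<open>Y\<close>
    is open both in \<open>X\<close> and in the image of \<open>?F\<close>, and its preimage is open
    in the plane.\<close>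
  define Y where "Y = X \<inter> (W \<inter> U \<inter> U')"
  have YR: "Y \<subseteq> \<Phi> ` ?R"
    using DU DU' X(4) unfolding Y_def by blast
  have "Y = \<Phi> ` ?F \<inter> (W \<inter> U \<inter> U')"
    using YR RF FX X(1) unfolding Y_def by blast
  then have "openin (top_of_set (\<Phi> ` ?F)) Y"
    using openin_open_Int[OF open_Int[OF open_Int[OF X(2) g(6)] g'(6)]] by simp
  then have "openin (top_of_set ?F) (\<Psi> ` Y)"
    by (rule homeomorphism_imp_open_map[OF homeomorphism_symD[OF hom]])
  moreover have \<Psi>Y: "\<Psi> ` Y \<subseteq> ?R"
  proof
    fix w assume "w \<in> \<Psi> ` Y"
    then obtain z where z: "z \<in> ?R" "w = \<Psi> (\<Phi> z)"
      using YR by blast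
    then have "\<Psi> (\<Phi> z) = z"
      by (intro homeomorphism_apply1[OF hom] subsetD[OF RF])
    then show "w \<in> ?R"
      using z by simp
  qed
  ultimately have "openin (top_of_set ?R) (\<Psi> ` Y)"
    using RF openin_subset_trans by blast
  moreover have "open ?R"
    by (intro open_Collect_conj open_Collect_less continuous_intros)
  ultimately have "open (\<Psi> ` Y)"
    using openin_open_trans by blast
  moreover have "Y \<subseteq> \<Phi> ` ?F"
    using YR RF by blast
  then have "homeomorphism Y (\<Psi> ` Y) \<Psi> \<Phi>"
    by (intro homeomorphism_of_subsets[OF homeomorphism_symD[OF hom], of _ "\<Psi> ` Y"])
       (use \<Psi>Y RF in auto)
  moreover have "openin (top_of_set X) Y"
    unfolding Y_def using X(2) g(6) g'(6) by (intro openin_open_Int open_Int)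
  moreover have "0 \<in> {-1..1::real}"
    by simp
  then have "\<gamma> 0 \<in> D"
    using \<gamma>D(1) surface_boundary_subset by blast
  then have "\<gamma> 0 \<in> Y"
    unfolding Y_def using X g(7) g'(7) by blast
  ultimately have "locally_planar X (\<gamma> 0)"
    unfolding locally_planar_def homeomorphic_def by blast
  then show ?thesis
    by (simp add: surface_boundary_eq)
qed

section \<open>Boundary components\<close>

lemma image_image_inverse: "(\<And>x. x \<in> A \<Longrightarrow> g (f x) = x) \<Longrightarrow> g ` f ` A = A"
  by force

lemma components_homeomorphism:
  assumes "homeomorphism X Y h k"
  shows "components Y = (`) h ` components X"
proof -
  \<comment> \<open>Proved for arbitrary spaces, so that it applies to \<open>h\<close> and to its
    inverse; the reverse inclusion is the second application.\<close>
  have sub: "(`) h ` components X \<subseteq> components Y" if hom: "homeomorphism X Y h k"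
    for X :: "'c::topological_space set" and Y :: "'d::topological_space set" and h k
  proof clarify
    fix C assume C: "C \<in> components X"
    have kh: "continuous_on X h" "continuous_on Y k" "h ` X = Y" "k ` Y = X"
      "\<And>x. x \<in> X \<Longrightarrow> k (h x) = x" "\<And>y. y \<in> Y \<Longrightarrow> h (k y) = y"
      using hom by (auto simp: homeomorphism_def)
    have CX: "C \<subseteq> X" "C \<noteq> {}" "connected C"
      using C in_components_subset in_components_nonempty in_components_connected by auto
    show "h ` C \<in> components Y"
      unfolding in_components_maximal
    proof (intro conjI allI impI)
      show "h ` C \<noteq> {}" "h ` C \<subseteq> Y"
        using CX kh(3) by auto
      show "connected (h ` C)"
        using CX kh(1) connected_continuous_image continuous_on_subset by blast
      fix d assume d: "d \<noteq> {} \<and> h ` C \<subseteq> d \<and> d \<subseteq> Y \<and> connected d"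
      then have "connected (k ` d)" "k ` d \<subseteq> X"
        using kh connected_continuous_image continuous_on_subset by blast+
      moreover have "C \<inter> k ` d \<noteq> {}"
        using CX(1,2) d kh(5) by (metis (no_types, lifting) disjoint_iff ex_in_conv image_eqI subsetD)
      ultimately have "k ` d \<subseteq> C"
        using components_maximal[OF C] by blast
      then have "h ` k ` d \<subseteq> h ` C"
        by (rule image_mono)
      moreover have "h ` k ` d = d"
        using d kh(6) by (intro image_image_inverse) blast
      ultimately show "d = h ` C"
        using d by auto
    qed
  qed
  have "C \<in> (`) h ` components X" if C: "C \<in> components Y" for C
  proof (rule image_eqI)
    show "k ` C \<in> components X"
      using sub[OF homeomorphism_symD[OF assms]] C by blast
    have "C \<subseteq> Y"
      using C in_components_subset by auto
    then show "C = h ` k ` C"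
      using homeomorphism_apply2[OF assms] by (intro image_image_inverse[symmetric]) blast
  qed
  then show ?thesis
    by (intro equalityI sub[OF assms] subsetI)
qed

lemma card_components_homeomorphism:
  assumes "homeomorphism X Y h k"
  shows "card (components Y) = card (components X)"
proof -
  have "inj_on h X"
    using assms by (auto simp: homeomorphism_def intro: inj_on_inverseI)
  then have "inj_on ((`) h) (components X)"
    by (intro inj_on_image) simp
  then show ?thesis
    unfolding components_homeomorphism[OF assms] by (rule card_image)
qed

section \<open>Boundary components that are whole boundary circles of discs\<close>

lemma openin_components_surface_boundary_disc:
  assumes "closed_disc D" "openin (top_of_set (surface_boundary D)) Y" "f \<in> components Y"
  shows "openin (top_of_set (surface_boundary D)) f"
proof -
  obtain k k' where k: "homeomorphism (cball 0 1 :: complex set) D k k'"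
    "surface_boundary D = k ` sphere 0 1"
    using assms(1) closed_discE by blast
  have "D = k ` cball 0 1"
    using k(1) by (auto simp: homeomorphism_def)
  then have hom: "homeomorphism (sphere 0 1) (surface_boundary D) k k'"
    using k(2) by (intro homeomorphism_of_subsets[OF k(1)]) auto
  let ?Z = "k' ` Y"
  have Y: "Y \<subseteq> surface_boundary D"
    using assms(2) openin_imp_subset by blast
  have oZ: "openin (top_of_set (sphere 0 1)) ?Z"
    by (rule homeomorphism_imp_open_map[OF homeomorphism_symD[OF hom] assms(2)])
  \<comment> \<open>The circle is locally connected, and so are its open subsets; in such a space
    components are open.\<close>
  have Z: "locally connected ?Z"
    by (rule locally_open_subset[OF locally_connected_sphere oZ])
  have homY: "homeomorphism Y ?Z k' k"
    using openin_imp_subset[OF oZ]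
    by (intro homeomorphism_of_subsets[OF homeomorphism_symD[OF hom] Y]) auto
  have "k' ` f \<in> components ?Z"
    unfolding components_homeomorphism[OF homY] using assms(3) by (rule imageI)
  then have "openin (top_of_set ?Z) (k' ` f)"
    by (rule openin_components_locally_connected[OF Z])
  then have "openin (top_of_set Y) (k ` k' ` f)"
    by (rule homeomorphism_imp_open_map[OF homeomorphism_symD[OF homY]])
  also have "k ` k' ` f = f"
    using in_components_subset[OF assms(3)] homeomorphism_apply1[OF homY]
    by (intro image_image_inverse) blast
  finally show ?thesis
    by (rule openin_trans[OF _ assms(2)])
qed

text \<open>The closed sets \<open>D\<close> and \<open>R\<close> would disconnect \<open>f\<close>
  if it met both, so \<open>f\<close> avoids \<open>R\<close>. It is then a component of the open
  subset \<open>surface_boundary D - R\<close> of a circle, hence open in the circle. It is also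
  closed, and the circle is connected.\<close>

lemma component_surface_boundary_eq_disc:
  assumes D: "closed_disc D" and R: "closed R"
    and f: "f \<in> components (surface_boundary (D \<union> R))" "f \<inter> D \<noteq> {}" "f \<inter> D \<inter> R = {}"
  shows "f = surface_boundary D"
proof -
  let ?B = "surface_boundary (D \<union> R)"
  have conn: "connected f" and ne: "f \<noteq> {}" and fB: "f \<subseteq> ?B"
    using in_components_connected[OF f(1)] in_components_nonempty[OF f(1)]
      in_components_subset[OF f(1)] by auto
  have cD: "closed D"
    by (rule closed_closed_disc[OF D])
  have "f \<subseteq> D \<union> R"
    using fB surface_boundary_subset by blast
  then have "R \<inter> f = {}"
    using connected_closedD[OF conn _ _ cD R] f(2,3) by blast
  then have sub: "f \<subseteq> surface_boundary D - R"
    using fB surface_boundary_Un_closed[OF R] by blast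
  have "surface_boundary D - R \<subseteq> ?B"
    using surface_boundary_Un_closed[OF R] by blast
  then have "f \<in> components (surface_boundary D - R)"
    by (rule components_intermediate_subset[OF f(1) sub])
  moreover have "openin (top_of_set (surface_boundary D)) (surface_boundary D - R)"
    unfolding Diff_eq using R by (intro openin_open_Int open_Compl)
  ultimately have "openin (top_of_set (surface_boundary D)) f"
    by (rule openin_components_surface_boundary_disc[OF D, rotated])
  moreover have "closed f"
    using cD R by (intro closed_components[OF _ f(1)] closed_surface_boundary closed_Un)
  then have "closedin (top_of_set (surface_boundary D)) f"
    using sub by (intro closed_subset) auto
  ultimately show ?thesis
    using connected_surface_boundary_disc[OF D] ne unfolding connected_clopen by blast
qed

lemma pairwise_disjnt_eq:
  "pairwise disjnt \<A> \<Longrightarrow> A \<in> \<A> \<Longrightarrow> B \<in> \<A> \<Longrightarrow> p \<in> A \<Longrightarrow> p \<in> B \<Longrightarrow> A = B"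
  by (metis disjnt_iff pairwiseD)

lemma closed_Union_discs:
  assumes "finite \<D>" "\<And>D. D \<in> \<D> \<Longrightarrow> closed_disc D"
  shows "closed (\<Union>\<D>)"
  using assms by (intro closed_Union) (auto intro: closed_closed_disc)

section \<open>Ribbon graphs\<close>

locale ribbon =
  fixes V E :: "'a::t2_space set set"
  assumes ribbon_graph: "ribbon_graph V E"
begin

lemma
  shows finite_V: "finite V" and finite_E: "finite E"
    and disc_V: "v \<in> V \<Longrightarrow> closed_disc v" and disc_E: "e \<in> E \<Longrightarrow> closed_disc e"
    and disjnt_V: "pairwise disjnt V" and disjnt_E: "pairwise disjnt E"
  using ribbon_graph by (auto simp: ribbon_graph_def)

abbreviation S where "S \<equiv> \<Union>V \<union> \<Union>E"

lemma disjoint_V: "v \<in> V \<Longrightarrow> v' \<in> V \<Longrightarrow> p \<in> v \<Longrightarrow> p \<in> v' \<Longrightarrow> v = v'"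
  and disjoint_E: "e \<in> E \<Longrightarrow> e' \<in> E \<Longrightarrow> p \<in> e \<Longrightarrow> p \<in> e' \<Longrightarrow> e = e'"
  using pairwise_disjnt_eq[OF disjnt_V] pairwise_disjnt_eq[OF disjnt_E] by simp_all

lemma closed_sub: "A \<subseteq> V \<union> E \<Longrightarrow> closed (\<Union>A)"
  using finite_V finite_E disc_V disc_E by (intro closed_Union_discs) (auto intro: finite_subset)

lemma segmentE:
  assumes "s \<in> segments V E"
  obtains v e where "v \<in> V" "e \<in> E" "s \<subseteq> surface_boundary v" "s \<subseteq> surface_boundary e"
  using assms ribbon_graph unfolding ribbon_graph_def by meson

text \<open>Finiteness is derived: each segment lies in one of the finitely many edges, and each
  edge contains exactly two.\<close>

lemma finite_segments: "finite (segments V E)"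
proof -
  have "finite {s \<in> segments V E. s \<subseteq> e}" if "e \<in> E" for e
  \<comment> \<open>Infinite sets have \<open>card\<close> 0, so cardinality 2 implies
    finiteness.\<close>
  proof (rule card_ge_0_finite)
    have "\<forall>e\<in>E. card {s \<in> segments V E. s \<subseteq> e} = 2"
      using ribbon_graph unfolding ribbon_graph_def by meson
    then show "0 < card {s \<in> segments V E. s \<subseteq> e}"
      using that by simp
  qed
  then have "finite (\<Union>e\<in>E. {s \<in> segments V E. s \<subseteq> e})"
    using finite_E by (rule finite_UN_I[rotated])
  moreover have "segments V E \<subseteq> (\<Union>e\<in>E. {s \<in> segments V E. s \<subseteq> e})"
  proof
    fix s assume s: "s \<in> segments V E"
    then obtain v e where "v \<in> V" "e \<in> E" "s \<subseteq> surface_boundary v" "s \<subseteq> surface_boundary e"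
      by (rule segmentE)
    then show "s \<in> (\<Union>e\<in>E. {s \<in> segments V E. s \<subseteq> e})"
      using s surface_boundary_subset[of e] by blast
  qed
  ultimately show ?thesis
    by (rule finite_subset[rotated])
qed

text \<open>A common point lies on some segment. By disjointness, the vertex and the edge that carry
  this segment must be \<open>v\<close> and \<open>e\<close>.\<close>

lemma vertex_edge_meet:
  assumes "v \<in> V" "e \<in> E"
  shows "v \<inter> e \<subseteq> surface_boundary v \<inter> surface_boundary e"
proof
  fix p assume p: "p \<in> v \<inter> e"
  then have "p \<in> \<Union>(segments V E)"
    using assms unfolding segments_def by auto
  then obtain s where s: "s \<in> segments V E" "p \<in> s"
    by blast
  obtain v' e' where ve: "v' \<in> V" "e' \<in> E" "s \<subseteq> surface_boundary v'" "s \<subseteq> surface_boundary e'"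
    by (rule segmentE[OF s(1)])
  then have "p \<in> v'" "p \<in> e'"
    using s(2) surface_boundary_subset[of v'] surface_boundary_subset[of e'] by blast+
  then have "v' = v" "e' = e"
    using disjoint_V[OF ve(1) assms(1)] disjoint_E[OF ve(2) assms(2)] p by blast+
  then show "p \<in> surface_boundary v \<inter> surface_boundary e"
    using ve s(2) by blast
qed

text \<open>Around a point other than its two ends, a segment provides an arc along which a vertex
  and an edge are glued, so the point is interior to the surface. Only the ends can lie on the
  boundary, and they are limits of the other points.\<close>

lemma segment_interior:
  assumes s: "s \<in> segments V E"
  obtains F where "finite F" "s \<inter> surface_boundary S \<subseteq> F" "s \<subseteq> closure (s - surface_boundary S)"
proof -
  have "s homeomorphic {0..1::real}"
    using s ribbon_graph unfolding ribbon_graph_def by meson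
  then obtain \<sigma> \<tau> where hom: "homeomorphism {0..1::real} s \<sigma> \<tau>"
    using homeomorphic_sym unfolding homeomorphic_def by blast
  have cont: "continuous_on {0..1} \<sigma>" and im: "\<sigma> ` {0..1} = s" and inj: "inj_on \<sigma> {0..1}"
    using hom by (auto simp: homeomorphism_def intro: inj_on_inverseI)
  obtain v e where ve: "v \<in> V" "e \<in> E" "s \<subseteq> surface_boundary v" "s \<subseteq> surface_boundary e"
    by (rule segmentE[OF s])
  have int: "\<sigma> t \<notin> surface_boundary S" if t: "0 < t" "t < 1" for t
  proof -
    \<comment> \<open>With this width, the subarc centred at parameter \<open>t\<close> stays within
      the segment when \<open>x\<close> runs from -1 to 1.\<close>
    define d where "d = min t (1 - t)"
    have d: "d > 0" "d \<le> t" "d \<le> 1 - t"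
      using t by (auto simp: d_def)
    define \<gamma> where "\<gamma> x = \<sigma> (t + d * x)" for x
    have range: "t + d * x \<in> {0..1}" if x: "x \<in> {-1..1}" for x
    proof -
      have "d * -1 \<le> d * x" "d * x \<le> d * 1"
        using x d(1) by (intro mult_left_mono; simp)+
      then show ?thesis
        unfolding atLeastAtMost_iff using d by linarith
    qed
    \<comment> \<open>These are the other discs. Their complement is the neighbourhood in which the
      surface consists of \<open>v\<close> and \<open>e\<close> alone.\<close>
    let ?R = "\<Union>(V - {v}) \<union> \<Union>(E - {e})"
    have cR: "closed ?R"
      using closed_sub[of "V - {v}"] closed_sub[of "E - {e}"] by auto
    have "\<sigma> t \<in> s"
      using im t by auto
    then have "\<sigma> t \<in> v" "\<sigma> t \<in> e"
      using ve surface_boundary_subset[of v] surface_boundary_subset[of e] by blast+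
    then have "\<sigma> t \<notin> ?R"
      using disjoint_V[OF ve(1)] disjoint_E[OF ve(2)] by blast
    moreover have "\<gamma> 0 = \<sigma> t"
      by (simp add: \<gamma>_def)
    moreover have "\<gamma> 0 \<notin> surface_boundary S"
    proof (rule glued_discs_interior)
      show "closed_disc v" "closed_disc e"
        using disc_V disc_E ve by auto
      show "v \<inter> e \<subseteq> surface_boundary v \<inter> surface_boundary e"
        using vertex_edge_meet ve by blast
      show "continuous_on {-1..1} \<gamma>"
        unfolding \<gamma>_def
        by (intro continuous_on_compose2[OF cont] continuous_intros) (use range in auto)
      show "inj_on \<gamma> {-1..1}"
      proof
        fix x y assume xy: "x \<in> {-1..1}" "y \<in> {-1..1}" "\<gamma> x = \<gamma> y"
        then have "t + d * x = t + d * y"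
          unfolding \<gamma>_def using inj_onD[OF inj] range by blast
        then show "x = y"
          using d(1) by simp
      qed
      have "\<gamma> x \<in> s" if "x \<in> {-1..1}" for x
        unfolding \<gamma>_def im[symmetric] using range[OF that] by (rule imageI)
      then show "\<gamma> ` {-1..1} \<subseteq> surface_boundary v \<inter> surface_boundary e"
        using ve by blast
      show "v \<union> e \<subseteq> S" "S \<inter> - ?R \<subseteq> v \<union> e"
        using ve by auto
      show "open (- ?R)"
        using cR by (rule open_Compl)
      show "\<gamma> 0 \<in> - ?R"
        using calculation by simp
    qed
    ultimately show ?thesis
      by simp
  qed
  show thesis
  proof
    show "finite {\<sigma> 0, \<sigma> 1}"
      by simp
    show "s \<inter> surface_boundary S \<subseteq> {\<sigma> 0, \<sigma> 1}"
    proof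
      fix p assume p: "p \<in> s \<inter> surface_boundary S"
      then obtain t where "t \<in> {0..1}" "p = \<sigma> t"
        using im by blast
      moreover from this have "\<not> (0 < t \<and> t < 1)"
        using int p by blast
      ultimately show "p \<in> {\<sigma> 0, \<sigma> 1}"
        by (cases "t = 0"; cases "t = 1") auto
    qed
    have "s = \<sigma> ` closure {0<..<1}"
      using im by simp
    also have "\<dots> \<subseteq> closure (\<sigma> ` {0<..<1})"
      by (rule continuous_image_closure_subset[OF cont]) simp
    also have "\<dots> \<subseteq> closure (s - surface_boundary S)"
    proof (rule closure_mono)
      show "\<sigma> ` {0<..<1} \<subseteq> s - surface_boundary S"
        using int im by auto
    qed
    finally show "s \<subseteq> closure (s - surface_boundary S)" .
  qed
qed

text \<open>The whole segment through a point of \<open>v \<inter> e\<close> lies in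
  \<open>v \<inter> e\<close>, so \<open>segment_interior\<close> applies. The capped setting
  retains this density statement in place of the segments.\<close>

lemma vertex_edge_closure:
  assumes "v \<in> V" "e \<in> E"
  shows "v \<inter> e \<subseteq> closure (v \<inter> e - surface_boundary S)"
proof
  fix p assume p: "p \<in> v \<inter> e"
  then have "p \<in> \<Union>(segments V E)"
    using assms unfolding segments_def by auto
  then obtain s where s: "s \<in> segments V E" "p \<in> s"
    by blast
  obtain v' e' where ve: "v' \<in> V" "e' \<in> E" "s \<subseteq> surface_boundary v'" "s \<subseteq> surface_boundary e'"
    by (rule segmentE[OF s(1)])
  then have sub: "s \<subseteq> v'" "s \<subseteq> e'"
    using surface_boundary_subset[of v'] surface_boundary_subset[of e'] by blast+
  then have "v' = v" "e' = e"
    using disjoint_V[OF ve(1) assms(1)] disjoint_E[OF ve(2) assms(2)] p s(2) by blast+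
  then have "s - surface_boundary S \<subseteq> v \<inter> e - surface_boundary S"
    using sub by blast
  moreover have "s \<subseteq> closure (s - surface_boundary S)"
    by (rule segment_interior[OF s(1)])
  ultimately show "p \<in> closure (v \<inter> e - surface_boundary S)"
    using s(2) closure_mono[of "s - surface_boundary S" "v \<inter> e - surface_boundary S"] by blast
qed

lemma finite_triple_points: "finite (surface_boundary S \<inter> (\<Union>V \<inter> \<Union>E))"
proof -
  have "finite (s \<inter> surface_boundary S)" if "s \<in> segments V E" for s
    using segment_interior[OF that] by (meson finite_subset)
  then have "finite (\<Union>s\<in>segments V E. s \<inter> surface_boundary S)"
    using finite_segments by (rule finite_UN_I[rotated])
  moreover have "\<Union>(segments V E) = \<Union>V \<inter> \<Union>E"
    unfolding segments_def by simp
  then have "surface_boundary S \<inter> (\<Union>V \<inter> \<Union>E) = (\<Union>s\<in>segments V E. s \<inter> surface_boundary S)"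
    by blast
  ultimately show ?thesis
    by simp
qed

text \<open>
  A boundary component that avoids the finitely many points of the boundary at which vertices and
  edges meet is the whole boundary of a single disc.
\<close>

lemma finite_boundary_components: "finite (boundary_components V E)"
proof -
  let ?P = "surface_boundary S \<inter> (\<Union>V \<inter> \<Union>E)"
  have "f \<in> connected_component_set (surface_boundary S) ` ?P \<union> surface_boundary ` (V \<union> E)"
    if f: "f \<in> components (surface_boundary S)" for f
  proof (cases "f \<inter> ?P = {}")
    case False
    then obtain p where p: "p \<in> f" "p \<in> ?P"
      by blast
    obtain x where "f = connected_component_set (surface_boundary S) x"
      using f by (rule componentsE)
    then have "f = connected_component_set (surface_boundary S) p"
      using p(1) by (metis connected_component_eq)
    then show ?thesis
      using p(2) by blast
  next
    case True
    have fS: "f \<subseteq> surface_boundary S" and "f \<noteq> {}"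
      using in_components_subset[OF f] in_components_nonempty[OF f] by auto
    then obtain D where D: "D \<in> V \<union> E" "f \<inter> D \<noteq> {}"
      using surface_boundary_subset[of S] by blast
    \<comment> \<open>The disc \<open>D\<close> is removed only from the family it is taken from.
      Members of that family are disjoint from \<open>D\<close>, and the other family is handled by
      the assumption that \<open>f\<close> avoids \<open>?P\<close>.\<close>
    define R where "R = \<Union>(if D \<in> V then V - {D} \<union> E else E - {D} \<union> V)"
    have S: "S = D \<union> R"
      unfolding R_def using D(1) by auto
    have cR: "closed R"
      unfolding R_def by (rule closed_sub) auto
    have "f \<inter> D \<inter> R = {}"
    proof (cases "D \<in> V")
      case True
      have "f \<inter> D \<inter> \<Union>(V - {D}) = {}"
        using disjoint_V[OF True] by blast
      moreover have "f \<inter> D \<inter> \<Union>E = {}"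
        using True fS \<open>f \<inter> ?P = {}\<close> by blast
      ultimately show ?thesis
        using True unfolding R_def by auto
    next
      case False
      then have "D \<in> E"
        using D by blast
      then have "f \<inter> D \<inter> \<Union>(E - {D}) = {}"
        using disjoint_E by blast
      moreover have "f \<inter> D \<inter> \<Union>V = {}"
        using \<open>D \<in> E\<close> fS \<open>f \<inter> ?P = {}\<close> by blast
      ultimately show ?thesis
        using False unfolding R_def by auto
    qed
    moreover have "closed_disc D"
      using D disc_V disc_E by blast
    moreover have "f \<in> components (surface_boundary (D \<union> R))"
      using f by (subst S[symmetric])
    ultimately have "f = surface_boundary D"
      using component_surface_boundary_eq_disc[OF _ cR _ D(2)] by simp
    moreover have "surface_boundary D \<in> surface_boundary ` (V \<union> E)"
      using D(1) by (rule imageI)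
    ultimately show ?thesis
      by simp
  qed
  then have "components (surface_boundary S)
      \<subseteq> connected_component_set (surface_boundary S) ` ?P \<union> surface_boundary ` (V \<union> E)"
    by (rule subsetI)
  moreover have "finite (connected_component_set (surface_boundary S) ` ?P \<union> surface_boundary ` (V \<union> E))"
    using finite_triple_points finite_V finite_E by simp
  ultimately show ?thesis
    unfolding boundary_components_def by (rule finite_subset)
qed

end

section \<open>Capped ribbon graphs\<close>

text \<open>All discs lie in one ambient space here; the embedding enters only when this is
  instantiated with the images of vertices and edges. The way in which vertices and edges are glued
  is recorded by \<open>meet\<close> and \<open>meet_closure\<close>.\<close>

locale capped_ribbon =
  fixes V E C :: "'a::t2_space set set"
  assumes finite_discs: "finite (V \<union> E \<union> C)"
    and discs: "D \<in> V \<union> E \<union> C \<Longrightarrow> closed_disc D"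
    and disjnt_V: "pairwise disjnt V" and disjnt_E: "pairwise disjnt E" and disjnt_C: "pairwise disjnt C"
    and meet: "v \<in> V \<Longrightarrow> e \<in> E \<Longrightarrow> v \<inter> e \<subseteq> surface_boundary v \<inter> surface_boundary e"
    and meet_closure:
      "v \<in> V \<Longrightarrow> e \<in> E \<Longrightarrow> v \<inter> e \<subseteq> closure (v \<inter> e - surface_boundary (\<Union>V \<union> \<Union>E))"
    and cap: "c \<in> C \<Longrightarrow> c \<inter> (\<Union>V \<union> \<Union>E) = surface_boundary c"
    and cap_component: "c \<in> C \<Longrightarrow> surface_boundary c \<in> components (surface_boundary (\<Union>V \<union> \<Union>E))"
    and caps: "surface_boundary (\<Union>V \<union> \<Union>E) \<subseteq> \<Union>C"
begin

abbreviation S where "S \<equiv> \<Union>V \<union> \<Union>E"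

lemma disjoint_V: "v \<in> V \<Longrightarrow> v' \<in> V \<Longrightarrow> p \<in> v \<Longrightarrow> p \<in> v' \<Longrightarrow> v = v'"
  and disjoint_E: "e \<in> E \<Longrightarrow> e' \<in> E \<Longrightarrow> p \<in> e \<Longrightarrow> p \<in> e' \<Longrightarrow> e = e'"
  and disjoint_C: "c \<in> C \<Longrightarrow> c' \<in> C \<Longrightarrow> p \<in> c \<Longrightarrow> p \<in> c' \<Longrightarrow> c = c'"
  using pairwise_disjnt_eq[OF disjnt_V] pairwise_disjnt_eq[OF disjnt_E]
    pairwise_disjnt_eq[OF disjnt_C] by simp_all

lemma closed_sub: "A \<subseteq> V \<union> E \<union> C \<Longrightarrow> closed (\<Union>A)"
  using finite_discs discs by (intro closed_Union_discs) (auto intro: finite_subset)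

text \<open>The form of locality used from here on: \<open>B\<close> collects discs that miss
  \<open>p\<close>, and the decomposition of \<open>Y\<close> is a separate premise to be checked
  set-theoretically.\<close>

lemma surface_boundary_local:
  assumes "B \<subseteq> V \<union> E \<union> C" "p \<notin> \<Union>B" "Y = X \<union> \<Union>B"
  shows "p \<in> surface_boundary Y \<longleftrightarrow> p \<in> surface_boundary X"
  using surface_boundary_Un_closed[OF closed_sub[OF assms(1)] assms(2)] assms(3) by simp

lemma cap_subset: "c \<in> C \<Longrightarrow> c \<inter> S \<subseteq> surface_boundary S"
  using cap in_components_subset[OF cap_component] by simp

lemma edge_boundary:
  assumes e: "e \<in> E" "p \<in> e" "p \<notin> \<Union>V"
  shows "p \<in> surface_boundary S \<longleftrightarrow> p \<in> surface_boundary e"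
proof (rule surface_boundary_local)
  show "V \<union> (E - {e}) \<subseteq> V \<union> E \<union> C" "S = e \<union> \<Union>(V \<union> (E - {e}))"
    using e(1) by auto
  show "p \<notin> \<Union>(V \<union> (E - {e}))"
    using e(3) disjoint_E[OF e(1) _ e(2)] by blast
qed

lemma surface_boundary_edge_subset:
  assumes "e \<in> E"
  shows "e \<inter> surface_boundary S \<subseteq> surface_boundary e"
proof
  fix p assume p: "p \<in> e \<inter> surface_boundary S"
  show "p \<in> surface_boundary e"
  proof (cases "p \<in> \<Union>V")
    case True
    then show ?thesis
      using meet[OF _ assms] p by blast
  next
    case False
    then show ?thesis
      using edge_boundary[OF assms] p by blast
  qed
qed

text \<open>Off the vertices, an arc of the boundary of \<open>e\<close> through \<open>p\<close>
  lies in the boundary of \<open>S\<close>. Being connected, it stays in the component of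
  \<open>p\<close>, which is the boundary of \<open>c\<close>. So \<open>e\<close> and
  \<open>c\<close> are glued along this arc.\<close>

lemma edge_cap_interior:
  assumes A: "A \<subseteq> E" and e: "e \<in> A" and c: "c \<in> C" and p: "p \<in> e" "p \<in> c" "p \<notin> \<Union>V"
  shows "p \<notin> surface_boundary (\<Union>C \<union> \<Union>A)"
proof -
  have eE: "e \<in> E"
    using A e by blast
  have cS: "c \<inter> S = surface_boundary c"
    by (rule cap[OF c])
  have pS: "p \<in> surface_boundary S"
    using cap_subset[OF c] p(1,2) eE by blast
  have ce: "closed_disc e" and cc: "closed_disc c"
    using discs eE c by blast+
  have pe: "p \<in> surface_boundary e"
    using edge_boundary[OF eE p(1,3)] pS by blast
  have V: "open (- \<Union>V)" "p \<in> - \<Union>V"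
    using p(3) by (auto intro!: open_Compl closed_sub)
  obtain \<gamma> :: "real \<Rightarrow> 'a" where \<gamma>: "continuous_on {-1..1} \<gamma>" "inj_on \<gamma> {-1..1}" "\<gamma> 0 = p"
    "\<gamma> ` {-1..1} \<subseteq> surface_boundary e \<inter> - \<Union>V"
    by (rule surface_boundary_disc_arc[OF ce pe V])
  have "\<gamma> ` {-1..1} \<subseteq> surface_boundary S"
  proof
    fix q assume "q \<in> \<gamma> ` {-1..1}"
    then have "q \<in> surface_boundary e" "q \<notin> \<Union>V"
      using \<gamma>(4) by blast+
    then show "q \<in> surface_boundary S"
      using edge_boundary[OF eE] surface_boundary_subset[of e] by blast
  qed
  moreover have "connected (\<gamma> ` {-1..1})"
    by (rule connected_continuous_image[OF \<gamma>(1) connected_Icc])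
  moreover have "p \<in> \<gamma> ` {-1..1}"
    using \<gamma>(3) by force
  moreover have "p \<in> surface_boundary c"
    using cS p(1,2) eE by blast
  ultimately have \<gamma>c: "\<gamma> ` {-1..1} \<subseteq> surface_boundary c"
    using components_maximal[OF cap_component[OF c], of "\<gamma> ` {-1..1}"] by blast
  let ?R = "\<Union>((A - {e}) \<union> (C - {c}))"
  have "\<gamma> 0 \<notin> surface_boundary (\<Union>C \<union> \<Union>A)"
  proof (rule glued_discs_interior)
    show "closed_disc e" "closed_disc c"
      by (fact ce cc)+
    have "e \<inter> c \<subseteq> surface_boundary S" "e \<inter> c \<subseteq> surface_boundary c"
      using cap_subset[OF c] cS eE by blast+
    then show "e \<inter> c \<subseteq> surface_boundary e \<inter> surface_boundary c"
      using surface_boundary_edge_subset[OF eE] by blast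
    show "continuous_on {-1..1} \<gamma>" "inj_on \<gamma> {-1..1}"
      by (fact \<gamma>)+
    show "\<gamma> ` {-1..1} \<subseteq> surface_boundary e \<inter> surface_boundary c"
      using \<gamma>(4) \<gamma>c by blast
    show "e \<union> c \<subseteq> \<Union>C \<union> \<Union>A"
      using e c by blast
    show "open (- ?R)"
      using A by (intro open_Compl closed_sub) blast
    have "p \<notin> ?R"
      using disjoint_E[OF eE _ p(1)] disjoint_C[OF c _ p(2)] A by blast
    then show "\<gamma> 0 \<in> - ?R"
      using \<gamma>(3) by simp
    show "(\<Union>C \<union> \<Union>A) \<inter> - ?R \<subseteq> e \<union> c"
      by blast
  qed
  then show ?thesis
    using \<gamma>(3) by simp
qed

section \<open>The complementary surfaces \<open>M\<close> and \<open>N\<close> and their common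
  boundary\<close>

context
  fixes A assumes A: "A \<subseteq> E"
begin

abbreviation M where "M \<equiv> \<Union>V \<union> \<Union>A"
abbreviation N where "N \<equiv> \<Union>C \<union> \<Union>(E - A)"

text \<open>Off the removed edges, \<open>M\<close> looks like \<open>S\<close>, whose boundary is
  where the caps are attached. On a removed edge, a point of \<open>M\<close> lies on a vertex and
  on no edge of \<open>A\<close>, so \<open>M\<close> looks like that vertex there, and
  \<open>meet\<close> puts the point on its boundary.\<close>

lemma surface_boundary_primal: "surface_boundary M = M \<inter> N"
proof (intro equalityI subsetI)
  fix p assume p: "p \<in> surface_boundary M"
  then have pM: "p \<in> M"
    using surface_boundary_subset[of M] by blast
  show "p \<in> M \<inter> N"
  proof (rule ccontr)
    assume "p \<notin> M \<inter> N"
    then have "p \<notin> \<Union>C" "p \<notin> \<Union>(E - A)"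
      using pM by blast+
    moreover have "S = M \<union> \<Union>(E - A)"
      using A by blast
    ultimately have "p \<in> surface_boundary S"
      using surface_boundary_local[of "E - A" p S M] p by blast
    then show False
      using caps \<open>p \<notin> \<Union>C\<close> by blast
  qed
next
  fix p assume p: "p \<in> M \<inter> N"
  show "p \<in> surface_boundary M"
  proof (cases "p \<in> \<Union>(E - A)")
    case True
    then obtain e where e: "e \<in> E" "e \<notin> A" "p \<in> e"
      by blast
    have nA: "p \<notin> \<Union>A"
      using disjoint_E[OF e(1) _ e(3)] A e(2) by blast
    then obtain v where v: "v \<in> V" "p \<in> v"
      using p by blast
    have "p \<in> surface_boundary v"
      using meet[OF v(1) e(1)] v(2) e(3) by blast
    moreover have "p \<notin> \<Union>(A \<union> (V - {v}))"
      using nA disjoint_V[OF v(1) _ v(2)] by blast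
    moreover have "M = v \<union> \<Union>(A \<union> (V - {v}))" "A \<union> (V - {v}) \<subseteq> V \<union> E \<union> C"
      using v(1) A by blast+
    ultimately show ?thesis
      using surface_boundary_local[of "A \<union> (V - {v})" p M v] by blast
  next
    case False
    then obtain c where c: "c \<in> C" "p \<in> c"
      using p by blast
    have "p \<in> surface_boundary S"
      using cap_subset[OF c(1)] c(2) p A by blast
    moreover have "S = M \<union> \<Union>(E - A)"
      using A by blast
    ultimately show ?thesis
      using surface_boundary_local[of "E - A" p S M] False by blast
  qed
qed

text \<open>There are three cases. A point on a cap and an edge is interior by gluing; a point on a
  cap alone is off \<open>S\<close> and thus interior to the cap; a point on an edge alone is
  interior to the edge, since the boundary of \<open>S\<close> is covered by caps.\<close>

lemma surface_boundary_dual_subset: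
  assumes p: "p \<in> N" "p \<notin> M"
  shows "p \<notin> surface_boundary N"
proof (cases "p \<in> \<Union>C")
  case True
  then obtain c where c: "c \<in> C" "p \<in> c"
    by blast
  show ?thesis
  proof (cases "p \<in> \<Union>(E - A)")
    case True
    then obtain e where "e \<in> E - A" "p \<in> e"
      by blast
    then show ?thesis
      using edge_cap_interior[of "E - A" e c p] c p(2) by blast
  next
    case False
    then have "p \<notin> S"
      using p(2) A by blast
    then have "p \<notin> surface_boundary c"
      using cap[OF c(1)] by blast
    moreover have "p \<notin> \<Union>((E - A) \<union> (C - {c}))"
      using False disjoint_C[OF c(1) _ c(2)] by blast
    moreover have "N = c \<union> \<Union>((E - A) \<union> (C - {c}))" "(E - A) \<union> (C - {c}) \<subseteq> V \<union> E \<union> C"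
      using c(1) by blast+
    ultimately show ?thesis
      using surface_boundary_local[of "(E - A) \<union> (C - {c})" p N c] by blast
  qed
next
  case False
  then obtain e where e: "e \<in> E" "e \<notin> A" "p \<in> e"
    using p(1) by blast
  have "p \<notin> surface_boundary e"
    using edge_boundary[OF e(1,3)] caps False p(2) by blast
  moreover have "p \<notin> \<Union>(C \<union> (E - A - {e}))"
    using False disjoint_E[OF e(1) _ e(3)] by blast
  moreover have "N = e \<union> \<Union>(C \<union> (E - A - {e}))" "C \<union> (E - A - {e}) \<subseteq> V \<union> E \<union> C"
    using e(1,2) by blast+
  ultimately show ?thesis
    using surface_boundary_local[of "C \<union> (E - A - {e})" p N e] by blast
qed

lemma surface_boundary_dual_edge:
  assumes e: "e \<in> E - A" "p \<in> e" and v: "v \<in> V" "p \<in> v" and "p \<notin> \<Union>C"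
  shows "p \<in> surface_boundary N"
proof -
  have "p \<in> surface_boundary e"
    using meet[OF v(1)] e v(2) by blast
  moreover have "p \<notin> \<Union>(C \<union> (E - A - {e}))"
    using assms(5) disjoint_E[OF _ _ e(2)] e(1) by blast
  moreover have "N = e \<union> \<Union>(C \<union> (E - A - {e}))" "C \<union> (E - A - {e}) \<subseteq> V \<union> E \<union> C"
    using e(1) by blast+
  ultimately show ?thesis
    using surface_boundary_local[of "C \<union> (E - A - {e})" p N e] by blast
qed

lemma surface_boundary_dual: "surface_boundary N = M \<inter> N"
proof (intro equalityI subsetI)
  fix p assume p: "p \<in> surface_boundary N"
  then show "p \<in> M \<inter> N"
    using surface_boundary_dual_subset[of p] surface_boundary_subset[of N] by blast
next
  fix p assume p: "p \<in> M \<inter> N"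
  show "p \<in> surface_boundary N"
  proof (cases "p \<in> \<Union>(E - A)")
    case False
    then obtain c where c: "c \<in> C" "p \<in> c"
      using p by blast
    have "p \<in> surface_boundary c"
      using cap[OF c(1)] c(2) p A by blast
    moreover have "p \<notin> \<Union>((E - A) \<union> (C - {c}))"
      using False disjoint_C[OF c(1) _ c(2)] by blast
    moreover have "N = c \<union> \<Union>((E - A) \<union> (C - {c}))" "(E - A) \<union> (C - {c}) \<subseteq> V \<union> E \<union> C"
      using c(1) by blast+
    ultimately show ?thesis
      using surface_boundary_local[of "(E - A) \<union> (C - {c})" p N c] by blast
  next
    case True
    then obtain e where e: "e \<in> E - A" "p \<in> e"
      by blast
    then have "p \<notin> \<Union>A"
      using disjoint_E[of e _ p] A by blast
    then obtain v where v: "v \<in> V" "p \<in> v"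
      using p by blast
    \<comment> \<open>Points off the boundary of \<open>S\<close> lie on no cap, so \<open>N\<close>
      looks like \<open>e\<close> there. The point \<open>p\<close> may lie on a cap as well and is
      reached as a limit of such points.\<close>
    have "v \<inter> e - surface_boundary S \<subseteq> surface_boundary N"
    proof
      fix q assume q: "q \<in> v \<inter> e - surface_boundary S"
      then have "q \<notin> \<Union>C"
        using cap_subset v(1) by blast
      then show "q \<in> surface_boundary N"
        using surface_boundary_dual_edge[OF e(1) _ v(1)] q by blast
    qed
    moreover have "closed N"
      using closed_sub[of C] closed_sub[of "E - A"] by blast
    then have "closed (surface_boundary N)"
      by (rule closed_surface_boundary)
    ultimately have "closure (v \<inter> e - surface_boundary S) \<subseteq> surface_boundary N"
      by (rule closure_minimal)
    then show ?thesis
      using meet_closure[OF v(1), of e] e v(2) by blast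
  qed
qed

end

end

section \<open>The dual polynomial\<close>

text \<open>The vertices are disjoint closed discs, so each component is the boundary circle of one
  of them. Applied to the complement of the full dual edge set, this counts the boundary components
  of the dual.\<close>

lemma (in ribbon) card_boundary_components_vertices: "card (boundary_components V {}) = card V"
proof -
  have eq: "f = surface_boundary v"
    if f: "f \<in> components (surface_boundary (\<Union>V))" and v: "v \<in> V" "f \<inter> v \<noteq> {}" for f v
  proof -
    have V: "v \<union> \<Union>(V - {v}) = \<Union>V"
      using v(1) by blast
    have R: "closed (\<Union>(V - {v}))"
      by (rule closed_sub) blast
    have "f \<inter> v \<inter> \<Union>(V - {v}) = {}"
      using disjoint_V[OF v(1)] by blast
    then show ?thesis
      using component_surface_boundary_eq_disc[OF disc_V[OF v(1)] R _ v(2)] f unfolding V by blast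
  qed
  have "components (surface_boundary (\<Union>V)) = surface_boundary ` V"
  proof (intro equalityI subsetI)
    fix f assume f: "f \<in> components (surface_boundary (\<Union>V))"
    then have "f \<noteq> {}" "f \<subseteq> surface_boundary (\<Union>V)"
      using in_components_nonempty[OF f] in_components_subset[OF f] by auto
    then obtain v where v: "v \<in> V" "f \<inter> v \<noteq> {}"
      using surface_boundary_subset[of "\<Union>V"] by blast
    then show "f \<in> surface_boundary ` V"
      using eq[OF f v] by simp
  next
    fix f assume "f \<in> surface_boundary ` V"
    then obtain v where v: "v \<in> V" "f = surface_boundary v"
      by blast
    then obtain p where p: "p \<in> surface_boundary v"
      using surface_boundary_disc_nonempty[OF disc_V] by blast
    then have pv: "p \<in> v"
      using surface_boundary_subset[of v] by blast
    have V: "v \<union> \<Union>(V - {v}) = \<Union>V"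
      using v(1) by blast
    have R: "closed (\<Union>(V - {v}))"
      by (rule closed_sub) blast
    have "p \<notin> \<Union>(V - {v})"
      using disjoint_V[OF v(1) _ pv] by blast
    then have pV: "p \<in> surface_boundary (\<Union>V)"
      using surface_boundary_Un_closed[OF R, of p v] p unfolding V by blast
    let ?f = "connected_component_set (surface_boundary (\<Union>V)) p"
    have f: "?f \<in> components (surface_boundary (\<Union>V))"
      by (rule componentsI[OF pV])
    have "p \<in> ?f"
      using pV by simp
    then have "?f = surface_boundary v"
      using eq[OF f v(1)] pv by blast
    then show "f \<in> components (surface_boundary (\<Union>V))"
      using f v(2) by simp
  qed
  moreover have "inj_on surface_boundary V"
  proof (rule inj_onI)
    fix v w assume vw: "v \<in> V" "w \<in> V" "surface_boundary v = surface_boundary w"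
    obtain p where "p \<in> surface_boundary v"
      using surface_boundary_disc_nonempty[OF disc_V[OF vw(1)]] by blast
    then have "p \<in> v" "p \<in> w"
      using vw(3) surface_boundary_subset[of v] surface_boundary_subset[of w] by blast+
    then show "v = w"
      by (rule disjoint_V[OF vw(1,2)])
  qed
  ultimately show ?thesis
    by (simp add: boundary_components_def card_image)
qed

text \<open>Walks are pushed forward along \<open>\<phi>\<close>, and walks that start at the image
  of a node are lifted back. Hence the connectivity classes correspond, and their number is the
  same.\<close>

lemma graph_rank_isomorphism:
  assumes nodes: "inj_on \<phi> (nodes \<Gamma>)" "nodes \<Gamma>' = \<phi> ` nodes \<Gamma>"
    and ends: "\<And>e. e \<in> A \<Longrightarrow> ends \<Gamma> e \<subseteq> nodes \<Gamma>" "\<And>e. e \<in> A \<Longrightarrow> ends \<Gamma>' (\<psi> e) = \<phi> ` ends \<Gamma> e"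
  shows "graph_rank \<Gamma>' (\<psi> ` A) = graph_rank \<Gamma> A"
proof -
  let ?N = "nodes \<Gamma>"
  let ?R = "{(u, v). \<exists>e\<in>A. u \<in> ends \<Gamma> e \<and> v \<in> ends \<Gamma> e}"
  let ?R' = "{(u, v). \<exists>e\<in>\<psi> ` A. u \<in> ends \<Gamma>' e \<and> v \<in> ends \<Gamma>' e}"
  have fwd: "(\<phi> u, \<phi> v) \<in> ?R'\<^sup>*" if "(u, v) \<in> ?R\<^sup>*" for u v
    using that
  proof induction
    case (step v w)
    then obtain e where "e \<in> A" "v \<in> ends \<Gamma> e" "w \<in> ends \<Gamma> e"
      by blast
    then have "(\<phi> v, \<phi> w) \<in> ?R'"
      using ends(2) by auto
    then show ?case
      using step.IH by (rule rtrancl_into_rtrancl[rotated])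
  qed simp
  have bwd: "\<exists>v\<in>?N. b = \<phi> v \<and> (u, v) \<in> ?R\<^sup>*" if "(\<phi> u, b) \<in> ?R'\<^sup>*" "u \<in> ?N" for u b
    using that(1)
  proof induction
    case base
    then show ?case
      using that(2) by blast
  next
    case (step b c)
    then obtain v where v: "v \<in> ?N" "b = \<phi> v" "(u, v) \<in> ?R\<^sup>*"
      by blast
    obtain e where e: "e \<in> A" "b \<in> \<phi> ` ends \<Gamma> e" "c \<in> \<phi> ` ends \<Gamma> e"
      using step.hyps(2) ends(2) by auto
    then obtain v' w where w: "v' \<in> ends \<Gamma> e" "b = \<phi> v'" "w \<in> ends \<Gamma> e" "c = \<phi> w"
      by blast
    \<comment> \<open>Injectivity of \<open>\<phi>\<close> joins the lift of the next edge, which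
      starts at \<open>v'\<close>, to the walk lifted so far, which ends at
      \<open>v\<close>.\<close>
    then have "v' = v"
      using v(1,2) ends(1)[OF e(1)] inj_onD[OF nodes(1)] by blast
    then have "(v, w) \<in> ?R"
      using e(1) w by blast
    then have "(u, w) \<in> ?R\<^sup>*"
      by (rule rtrancl_into_rtrancl[OF v(3)])
    then show ?case
      using w ends(1)[OF e(1)] by blast
  qed
  have cls: "connected_nodes \<Gamma>' (\<psi> ` A) `` {\<phi> u} = \<phi> ` (connected_nodes \<Gamma> A `` {u})"
    if u: "u \<in> ?N" for u
  proof (intro equalityI subsetI)
    fix b assume "b \<in> connected_nodes \<Gamma>' (\<psi> ` A) `` {\<phi> u}"
    then have "(\<phi> u, b) \<in> ?R'\<^sup>*"
      unfolding connected_nodes_def by blast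
    then obtain v where "v \<in> ?N" "b = \<phi> v" "(u, v) \<in> ?R\<^sup>*"
      using bwd[OF _ u] by blast
    then show "b \<in> \<phi> ` (connected_nodes \<Gamma> A `` {u})"
      using u unfolding connected_nodes_def by blast
  next
    fix b assume "b \<in> \<phi> ` (connected_nodes \<Gamma> A `` {u})"
    then obtain v where v: "b = \<phi> v" "v \<in> ?N" "(u, v) \<in> ?R\<^sup>*"
      unfolding connected_nodes_def by blast
    then show "b \<in> connected_nodes \<Gamma>' (\<psi> ` A) `` {\<phi> u}"
      using fwd[OF v(3)] u nodes(2) unfolding connected_nodes_def by blast
  qed
  have "nodes \<Gamma>' // connected_nodes \<Gamma>' (\<psi> ` A) = (`) \<phi> ` (?N // connected_nodes \<Gamma> A)"
    unfolding quotient_def nodes(2) image_UN UN_extend_simps using cls by auto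
  moreover have "inj_on ((`) \<phi>) (?N // connected_nodes \<Gamma> A)"
  proof (rule inj_on_image, rule inj_on_subset[OF nodes(1)])
    show "\<Union>(?N // connected_nodes \<Gamma> A) \<subseteq> ?N"
      unfolding quotient_def connected_nodes_def by blast
  qed
  ultimately show ?thesis
    by (simp add: graph_rank_def card_image nodes)
qed

section \<open>The embedded ribbon graph and its caps\<close>

locale ribbon_dual = ribbon V E
  for V E :: "'a::t2_space set set" +
  fixes h :: "'a \<Rightarrow> 'b::t2_space" and V' E' :: "'b set set" and g :: "'b \<Rightarrow> 'a" and cap :: "'a set \<Rightarrow> 'b set"
  assumes embedding: "homeomorphism S (h ` S) h g"
    and E': "E' = (`) h ` E"
    and bij_cap: "bij_betw cap (boundary_components V E) V'"
    and disc_cap: "f \<in> boundary_components V E \<Longrightarrow> closed_disc (cap f)"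
    and cap_Int: "f \<in> boundary_components V E \<Longrightarrow> cap f \<inter> h ` S = h ` f"
    and surface_boundary_cap: "f \<in> boundary_components V E \<Longrightarrow> surface_boundary (cap f) = h ` f"
    and disjnt_V': "pairwise disjnt V'"
begin

lemma inj_h: "inj_on h S"
  using homeomorphism_apply1[OF embedding] by (rule inj_on_inverseI)

lemma inj_image: "inj_on ((`) h) (Pow S)"
  by (rule inj_on_image_Pow[OF inj_h])

lemma embedding_subset: "X \<subseteq> S \<Longrightarrow> homeomorphism X (h ` X) h g"
  by (rule homeomorphism_of_subsets[OF embedding, of _ "h ` X"]) auto

lemma surface_boundary_image: "X \<subseteq> S \<Longrightarrow> surface_boundary (h ` X) = h ` surface_boundary X"
  by (rule surface_boundary_homeomorphism[OF embedding_subset])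

lemma boundary_component_subset:
  assumes "f \<in> boundary_components V E"
  shows "f \<subseteq> surface_boundary S" "f \<subseteq> S"
  using in_components_subset[of f "surface_boundary S"] assms surface_boundary_subset[of S]
  unfolding boundary_components_def by blast+

lemma closed_disc_image: "D \<subseteq> S \<Longrightarrow> closed_disc D \<Longrightarrow> closed_disc (h ` D)"
  using embedding_subset[of D] unfolding closed_disc_def
  by (meson homeomorphic_def homeomorphic_sym homeomorphic_trans)

lemma pairwise_disjnt_image:
  assumes "pairwise disjnt \<A>" "\<Union>\<A> \<subseteq> S"
  shows "pairwise disjnt ((`) h ` \<A>)"
proof (rule pairwiseI)
  fix X Y assume XY: "X \<in> (`) h ` \<A>" "Y \<in> (`) h ` \<A>" "X \<noteq> Y"
  then obtain D F where D: "D \<in> \<A>" "F \<in> \<A>" "X = h ` D" "Y = h ` F"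
    by blast
  then have "D \<inter> F = {}"
    using assms(1) XY(3) by (metis disjnt_def pairwiseD)
  then have "h ` D \<inter> h ` F = {}"
    using D(1,2) assms(2) inj_on_image_Int[OF inj_h, of D F] by blast
  then show "disjnt X Y"
    using D by (simp add: disjnt_def)
qed

sublocale capped: capped_ribbon "(`) h ` V" "(`) h ` E" V'
proof
  have S: "\<Union>((`) h ` V) \<union> \<Union>((`) h ` E) = h ` S"
    by blast
  have bd: "surface_boundary (h ` S) = h ` surface_boundary S"
    by (rule surface_boundary_image) simp
  have sub: "v \<subseteq> S" if "v \<in> V \<union> E" for v
    using that by blast
  have capE: "\<exists>f\<in>boundary_components V E. c = cap f" if "c \<in> V'" for c
    using that bij_betw_imp_surj_on[OF bij_cap] by blast
  \<comment> \<open>The caps correspond to boundary components, so their finiteness rests on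
    \<open>finite_boundary_components\<close>.\<close>
  have "finite V'"
    using bij_betw_finite[OF bij_cap] finite_boundary_components by blast
  then show "finite ((`) h ` V \<union> (`) h ` E \<union> V')"
    using finite_V finite_E by blast
  show "closed_disc D" if D: "D \<in> (`) h ` V \<union> (`) h ` E \<union> V'" for D
  proof (cases "D \<in> V'")
    case True
    then show ?thesis
      using capE disc_cap by blast
  next
    case False
    then obtain X where X: "X \<in> V \<union> E" "D = h ` X"
      using D by blast
    then have "closed_disc X"
      using disc_V disc_E by blast
    then show ?thesis
      unfolding X(2) by (rule closed_disc_image[OF sub[OF X(1)]])
  qed
  show "pairwise disjnt ((`) h ` V)"
    by (rule pairwise_disjnt_image[OF disjnt_V]) blast
  show "pairwise disjnt ((`) h ` E)"
    by (rule pairwise_disjnt_image[OF disjnt_E]) blast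
  show "pairwise disjnt V'"
    by (fact disjnt_V')
  fix v' e' assume "v' \<in> (`) h ` V" "e' \<in> (`) h ` E"
  then obtain v e where ve: "v \<in> V" "e \<in> E" "v' = h ` v" "e' = h ` e"
    by blast
  have vS: "v \<subseteq> S" "e \<subseteq> S"
    using ve(1,2) by blast+
  have int: "h ` v \<inter> h ` e = h ` (v \<inter> e)"
    by (rule inj_on_image_Int[OF inj_h vS, symmetric])
  have "h ` (v \<inter> e) \<subseteq> h ` surface_boundary v \<inter> h ` surface_boundary e"
    using vertex_edge_meet[OF ve(1,2)] by blast
  then show "v' \<inter> e' \<subseteq> surface_boundary v' \<inter> surface_boundary e'"
    unfolding ve(3,4) int surface_boundary_image[OF vS(1)] surface_boundary_image[OF vS(2)] .
  let ?B = "v \<inter> e - surface_boundary S"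
  \<comment> \<open>The map \<open>h\<close> is known to be continuous only on \<open>S\<close>, so
    the closure has to stay inside \<open>S\<close> before it can be mapped.\<close>
  have "closed S"
    using closed_sub[of V] closed_sub[of E] by blast
  then have "closure ?B \<subseteq> S"
    using vS by (intro closure_minimal) blast+
  moreover have "continuous_on S h"
    using embedding by (simp add: homeomorphism_def)
  ultimately have "h ` closure ?B \<subseteq> closure (h ` ?B)"
    by (intro continuous_image_closure_subset)
  moreover have "h ` ?B = h ` (v \<inter> e) - h ` surface_boundary S"
    using vS surface_boundary_subset[of S] by (intro inj_on_image_set_diff[OF inj_h]) blast+
  ultimately have "h ` (v \<inter> e) \<subseteq> closure (h ` (v \<inter> e) - h ` surface_boundary S)"
    using image_mono[OF vertex_edge_closure[OF ve(1,2)], of h] by simp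
  then show "v' \<inter> e' \<subseteq> closure (v' \<inter> e' - surface_boundary (\<Union>((`) h ` V) \<union> \<Union>((`) h ` E)))"
    unfolding ve(3,4) int S bd .
next
  have S: "\<Union>((`) h ` V) \<union> \<Union>((`) h ` E) = h ` S"
    by blast
  have bd: "surface_boundary (h ` S) = h ` surface_boundary S"
    by (rule surface_boundary_image) simp
  have "surface_boundary S = \<Union>(boundary_components V E)"
    unfolding boundary_components_def by simp
  then have "h ` surface_boundary S = \<Union>((`) h ` boundary_components V E)"
    by blast
  moreover have "h ` f \<subseteq> \<Union>V'" if "f \<in> boundary_components V E" for f
    using cap_Int[OF that] bij_betwE[OF bij_cap] that by blast
  ultimately show "surface_boundary (\<Union>((`) h ` V) \<union> \<Union>((`) h ` E)) \<subseteq> \<Union>V'"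
    unfolding S bd by blast
  fix c assume "c \<in> V'"
  then obtain f where f: "f \<in> boundary_components V E" "c = cap f"
    using bij_betw_imp_surj_on[OF bij_cap] by blast
  show "c \<inter> (\<Union>((`) h ` V) \<union> \<Union>((`) h ` E)) = surface_boundary c"
    unfolding S f(2) cap_Int[OF f(1)] surface_boundary_cap[OF f(1)] ..
  have "homeomorphism (surface_boundary S) (h ` surface_boundary S) h g"
    by (intro embedding_subset surface_boundary_subset)
  then have "components (h ` surface_boundary S) = (`) h ` components (surface_boundary S)"
    by (rule components_homeomorphism)
  then show "surface_boundary c \<in> components (surface_boundary (\<Union>((`) h ` V) \<union> \<Union>((`) h ` E)))"
    using f(1) unfolding S bd f(2) surface_boundary_cap[OF f(1)] boundary_components_def by simp
qed

text \<open>In the capped surface, the embedded subgraph on \<open>A\<close> and the dual subgraph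
  on the complementary edges have literally the same boundary. The embedding carries the boundary
  for \<open>A\<close> onto it, preserving components.\<close>

lemma card_boundary_components_dual:
  assumes A: "A \<subseteq> E"
  shows "card (boundary_components V' ((`) h ` (E - A))) = card (boundary_components V A)"
proof -
  let ?M = "\<Union>V \<union> \<Union>A"
  have "(`) h ` (E - A) = (`) h ` E - (`) h ` A"
    using A by (intro inj_on_image_set_diff[OF inj_image]) blast+
  moreover have "(`) h ` A \<subseteq> (`) h ` E"
    using A by blast
  ultimately have "surface_boundary (\<Union>V' \<union> \<Union>((`) h ` (E - A)))
      = surface_boundary (\<Union>((`) h ` V) \<union> \<Union>((`) h ` A))"
    using capped.surface_boundary_primal capped.surface_boundary_dual by simp
  also have "\<Union>((`) h ` V) \<union> \<Union>((`) h ` A) = h ` ?M"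
    by blast
  also have "surface_boundary (h ` ?M) = h ` surface_boundary ?M"
    using A by (intro surface_boundary_image) blast
  finally have "card (boundary_components V' ((`) h ` (E - A)))
      = card (components (h ` surface_boundary ?M))"
    unfolding boundary_components_def by simp
  also have "\<dots> = card (components (surface_boundary ?M))"
    using A surface_boundary_subset[of ?M]
    by (intro card_components_homeomorphism[OF embedding_subset]) blast
  finally show ?thesis
    unfolding boundary_components_def .
qed

section \<open>Comparison of the parameters and of the polynomials\<close>

lemma card_V': "card V' = card (boundary_components V E)"
  using bij_betw_same_card[OF bij_cap] by simp

lemma card_edges_image: "A \<subseteq> E \<Longrightarrow> card ((`) h ` A) = card A"
  by (intro card_image inj_on_subset[OF inj_image]) blast

lemma rho_dual:
  assumes A: "A \<subseteq> E"
  shows "rho V E - rho V A = of_nat (card ((`) h ` (E - A))) - rho V' ((`) h ` (E - A))"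
    and "rho V' E' - rho V' ((`) h ` (E - A)) = of_nat (card A) - rho V A"
proof -
  have "card (E - A) = card E - card A" "card A \<le> card E"
    using A finite_E card_Diff_subset finite_subset card_mono by metis+
  then have card: "(of_nat (card ((`) h ` (E - A))) :: rat) = of_nat (card E) - of_nat (card A)"
    using card_edges_image[of "E - A"] by (simp add: of_nat_diff)
  have b: "card (boundary_components V' ((`) h ` (E - A))) = card (boundary_components V A)"
    by (rule card_boundary_components_dual[OF A])
  \<comment> \<open>The full dual is complementary to \<open>A = {}\<close>, that is, to the
    vertices without edges.\<close>
  have "card (boundary_components V' E') = card V"
    using card_boundary_components_dual[of "{}"] card_boundary_components_vertices E' by simp
  moreover have "card E' = card E"
    using card_edges_image E' by simp
  ultimately show "rho V E - rho V A = of_nat (card ((`) h ` (E - A))) - rho V' ((`) h ` (E - A))"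
    and "rho V' E' - rho V' ((`) h ` (E - A)) = of_nat (card A) - rho V A"
    unfolding rho_def card b card_V' by (simp_all add: field_simps)
qed

text \<open>Capping identifies the colour classes, and it preserves incidence: an edge of the dual
  lies in the embedded surface, which a cap meets only in its boundary component.\<close>

lemma graph_rank_dual:
  assumes \<B>: "\<And>\<beta>. \<beta> \<in> \<B> \<Longrightarrow> \<beta> \<subseteq> boundary_components V E" and A: "A \<subseteq> E"
  shows "graph_rank (vertex_quotient V' E' (induced_colouring h \<B> V')) ((`) h ` A)
    = graph_rank (boundary_quotient V E \<B>) A"
proof -
  have col: "{v \<in> V'. \<exists>f\<in>\<beta>. surface_boundary v = h ` f} = cap ` \<beta>" if \<beta>: "\<beta> \<in> \<B>" for \<beta>
  proof (intro equalityI subsetI)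
    fix v assume "v \<in> {v \<in> V'. \<exists>f\<in>\<beta>. surface_boundary v = h ` f}"
    then obtain f where f: "v \<in> V'" "f \<in> \<beta>" "surface_boundary v = h ` f"
      by blast
    then obtain f' where f': "f' \<in> boundary_components V E" "v = cap f'"
      using bij_betw_imp_surj_on[OF bij_cap] by blast
    have fb: "f \<in> boundary_components V E"
      using f(2) \<B>[OF \<beta>] by blast
    have "h ` f' = h ` f"
      using f(3) f'(2) surface_boundary_cap[OF f'(1)] by simp
    then have "f' = f"
      using inj_on_image_eq_iff[OF inj_h boundary_component_subset(2)[OF f'(1)]
          boundary_component_subset(2)[OF fb]] by simp
    then show "v \<in> cap ` \<beta>"
      using f(2) f'(2) by blast
  next
    fix v assume "v \<in> cap ` \<beta>"
    then obtain f where f: "f \<in> \<beta>" "v = cap f"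
      by blast
    then have fb: "f \<in> boundary_components V E"
      using \<B>[OF \<beta>] by blast
    then have "v \<in> V'"
      using f(2) bij_betwE[OF bij_cap] by blast
    then show "v \<in> {v \<in> V'. \<exists>f\<in>\<beta>. surface_boundary v = h ` f}"
      using f surface_boundary_cap[OF fb] by blast
  qed
  have col': "induced_colouring h \<B> V' = (`) cap ` \<B>"
    unfolding induced_colouring_def using col by (intro image_cong) auto
  have inj: "inj_on ((`) cap) \<B>"
    by (rule inj_on_subset[OF inj_on_image_Pow[OF bij_betw_imp_inj_on[OF bij_cap]]]) (use \<B> in blast)
  have touch: "cap f \<inter> h ` e \<noteq> {} \<longleftrightarrow> f \<inter> e \<noteq> {}" if fe: "\<beta> \<in> \<B>" "f \<in> \<beta>" "e \<in> E" for \<beta> f e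
  proof -
    have fb: "f \<in> boundary_components V E"
      using fe \<B> by blast
    have eS: "e \<subseteq> S"
      using fe(3) by blast
    then have "cap f \<inter> h ` e = h ` f \<inter> h ` e"
      unfolding cap_Int[OF fb, symmetric] by blast
    also have "\<dots> = h ` (f \<inter> e)"
      by (rule inj_on_image_Int[OF inj_h boundary_component_subset(2)[OF fb] eS, symmetric])
    finally show ?thesis
      by simp
  qed
  show ?thesis
  proof (rule graph_rank_isomorphism)
    show "inj_on ((`) cap) (nodes (boundary_quotient V E \<B>))"
      using inj by (simp add: boundary_quotient_def)
    show "nodes (vertex_quotient V' E' (induced_colouring h \<B> V'))
        = (`) cap ` nodes (boundary_quotient V E \<B>)"
      by (simp add: boundary_quotient_def vertex_quotient_def col')
    fix e assume "e \<in> A"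
    then have e: "e \<in> E"
      using A by blast
    show "ends (boundary_quotient V E \<B>) e \<subseteq> nodes (boundary_quotient V E \<B>)"
      by (auto simp: boundary_quotient_def)
    have image_filter: "{c \<in> (`) cap ` \<B>. P c} = (`) cap ` {\<beta> \<in> \<B>. P (cap ` \<beta>)}" for P
      by blast
    have "(\<exists>v\<in>cap ` \<beta>. v \<inter> h ` e \<noteq> {}) \<longleftrightarrow> (\<exists>f\<in>\<beta>. f \<inter> e \<noteq> {})" if \<beta>: "\<beta> \<in> \<B>" for \<beta>
      unfolding bex_simps(7) by (rule bex_cong[OF refl]) (rule touch[OF \<beta> _ e])
    then have "{\<beta> \<in> \<B>. \<exists>v\<in>cap ` \<beta>. v \<inter> h ` e \<noteq> {}} = {\<beta> \<in> \<B>. \<exists>f\<in>\<beta>. f \<inter> e \<noteq> {}}"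
      by (intro Collect_cong conj_cong refl)
    then have "{c \<in> (`) cap ` \<B>. \<exists>v\<in>c. v \<inter> h ` e \<noteq> {}} = (`) cap ` {\<beta> \<in> \<B>. \<exists>f\<in>\<beta>. f \<inter> e \<noteq> {}}"
      unfolding image_filter by simp
    then show "ends (vertex_quotient V' E' (induced_colouring h \<B> V')) (h ` e)
        = (`) cap ` ends (boundary_quotient V E \<B>) e"
      by (simp add: boundary_quotient_def vertex_quotient_def col')
  qed
qed

lemma T_s_dual:
  assumes \<B>: "\<And>\<beta>. \<beta> \<in> \<B> \<Longrightarrow> \<beta> \<subseteq> boundary_components V E"
  shows "T_s V E \<B> x y z = T_cps V' E' (induced_colouring h \<B> V') y z x"
  unfolding T_s_def T_cps_def
\<comment> \<open>The inverse of complementing in \<open>E\<close> and mapping by \<open>h\<close>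
  sends \<open>B\<close> to the edges whose images are not in \<open>B\<close>.\<close>
proof (rule sum.reindex_bij_witness)
  let ?\<V> = "induced_colouring h \<B> V'"
  fix A assume "A \<in> Pow E"
  then have A: "A \<subseteq> E"
    by simp
  show "E - {e \<in> E. h ` e \<in> (`) h ` (E - A)} = A"
  proof -
    have "h ` e \<in> (`) h ` (E - A) \<longleftrightarrow> e \<in> E - A" if "e \<in> E" for e
      by (rule inj_on_image_mem_iff[OF inj_image]) (use that in blast)+
    then show ?thesis
      using A by blast
  qed
  show "(`) h ` (E - A) \<in> Pow E'"
    using E' by blast
  have rank: "graph_rank (vertex_quotient V' E' ?\<V>) E' = graph_rank (boundary_quotient V E \<B>) E"
    "graph_rank (vertex_quotient V' E' ?\<V>) ((`) h ` (E - A)) = graph_rank (boundary_quotient V E \<B>) (E - A)"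
    using graph_rank_dual[OF \<B>, of \<B> E] graph_rank_dual[OF \<B>, of \<B> "E - A"] E' by auto
  have "r1 V' E' ?\<V> E' - r1 V' E' ?\<V> ((`) h ` (E - A)) = r3 V E \<B> A"
    unfolding r1_def r3_def rank ..
  \<comment> \<open>The rank differences agree by the isomorphism of the quotients, and the
    remaining part \<open>card A - rho V A\<close> of \<open>r4\<close> is the difference of the
    dual \<open>rho\<close> values.\<close>
  moreover have "r2 V' E' ?\<V> E' - r2 V' E' ?\<V> ((`) h ` (E - A)) = r4 V E \<B> A"
    unfolding r2_def r4_def rank using rho_dual(2)[OF A] by linarith
  ultimately show "var_power y (r1 V' E' ?\<V> E' - r1 V' E' ?\<V> ((`) h ` (E - A))) *
      var_power z (r2 V' E' ?\<V> E' - r2 V' E' ?\<V> ((`) h ` (E - A))) *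
      var_power x (of_nat (card ((`) h ` (E - A))) - rho V' ((`) h ` (E - A))) =
      var_power x (rho V E - rho V A) * var_power y (r3 V E \<B> A) * var_power z (r4 V E \<B> A)"
    using rho_dual(1)[OF A] by (simp add: ac_simps)
next
  fix B assume "B \<in> Pow E'"
  then show "(`) h ` (E - (E - {e \<in> E. h ` e \<in> B})) = B"
    unfolding E' by blast
  show "E - {e \<in> E. h ` e \<in> B} \<in> Pow E"
    by blast
qed

end

theorem theorem4p6:
  fixes V E :: "'a::t2_space set set" and \<B> :: "'a set set set"
    and V' E' :: "'b::t2_space set set" and \<V> :: "'b set set set"
    and h :: "'a \<Rightarrow> 'b" and x y z :: 'v
  assumes "boundary_coloured V E \<B>"
    and "coloured_dual h V E \<B> V' E' \<V>"
  shows "T_s V E \<B> x y z = T_cps V' E' \<V> y z x"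
proof -
  have rib: "ribbon_graph V E" and part: "partition_on (boundary_components V E) \<B>"
    using assms(1) by (auto simp: boundary_coloured_def)
  have dual: "geometric_dual h V E V' E'" and \<V>: "\<V> = induced_colouring h \<B> V'"
    using assms(2) by (auto simp: coloured_dual_def)
  let ?S = "\<Union>V \<union> \<Union>E"
  obtain g where g: "homeomorphism ?S (h ` ?S) h g"
    using dual unfolding geometric_dual_def Let_def by (elim conjE exE)
  obtain cap where cap: "bij_betw cap (boundary_components V E) V'"
    "\<forall>f\<in>boundary_components V E. closed_disc (cap f) \<and> cap f \<inter> h ` ?S = h ` f \<and>
       surface_boundary (cap f) = h ` f"
    using dual unfolding geometric_dual_def Let_def by (elim conjE exE)
  have "E' = (`) h ` E" "pairwise disjnt V'"
    using dual unfolding geometric_dual_def Let_def by simp_all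
  then have "ribbon_dual V E h V' E' g cap"
    using rib g cap by unfold_locales simp_all
  then interpret ribbon_dual V E h V' E' g cap .
  have "\<beta> \<subseteq> boundary_components V E" if "\<beta> \<in> \<B>" for \<beta>
    using part that unfolding partition_on_def by blast
  then show ?thesis
    unfolding \<V> by (rule T_s_dual)
qed

end
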